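(* Let $\varphi\colon X\to\mathbb{CP}^3$ be a transverse $J$-holomorphic curve in nearly Kähler $\mathbb{CP}^3$ with angle function $\alpha_-$ and second fundamental form $\mathrm{I\!I}\in\Omega^{1,0}(X,\mathrm{Hom}(TX,\nu))$. Then $$d_{\overline\nabla}(\mathrm{I\!I})=\frac{2i\alpha_-}{\alpha_-^2+1}\,(-2+3\alpha_-^2)\ \mathrm{vol}_{\mathcal H}\otimes u_1\otimes f_2 .$$ In particular, there is no transverse $J$-holomorphic curve with holomorphic second fundamental form (i.e. with $d_{\overline\nabla}(\mathrm{I\!I})\equiv0$).
   Context: Nearly Kähler $\mathbb{CP}^3$: identify $\mathbb{H}=\mathbb{C}\oplus j\mathbb{C}$ and $\mathbb{H}^2\cong\mathbb{C}^4$ via $(z_0+jz_1,z_2+jz_3)\leftrightarrow(z_0,z_1,z_2,z_3)$. $\mathrm{Sp}(2)$ acts transitively on $\mathbb{CP}^3$ with stabiliser $S^1\times S^3=\{\mathrm{diag}(z,q)\}$ of $[1,0,0,0]$. Write the left-invariant Maurer–Cartan form as $$\Omega_{MC}=\begin{pmatrix} i\rho_1+j\overline{\omega_3} & -\frac{\overline{\omega_1}}{\sqrt2}+j\frac{\omega_2}{\sqrt2}\\ \frac{\omega_1}{\sqrt2}+j\frac{\omega_2}{\sqrt2} & i\rho_2+j\tau\end{pmatrix}$$ with $\omega_i,\tau$ complex-valued and $\rho_i$ real. $J$ and $g$ are determined by requiring that $s^*\omega_1,s^*\omega_2,s^*\omega_3$ be unitary $(1,0)$-forms for every local section $s$ of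 $\mathrm{Sp}(2)\to\mathbb{CP}^3$. $\overline\nabla$ is the nearly Kähler connection, the unique connection with skew-symmetric torsion and holonomy in $\mathrm{SU}(3)$; in the frame $(e_1,e_2,e_3)$ dual to $(\omega_1,\omega_2,\omega_3)$ it is $\overline\nabla e_b=\sum_a\kappa_{ab}e_a$ with $$\kappa=\begin{pmatrix} i(\rho_2-\rho_1)&-\overline\tau&0\\ \tau&-i(\rho_1+\rho_2)&0\\0&0&2i\rho_1\end{pmatrix}.$$ $\mathcal V$ (where $\omega_1=\omega_2=0$) is the vertical bundle of the twistor fibration $\mathbb{CP}^3\to S^4$, $\mathcal H=\mathcal V^\perp$ (where $\omega_3=0$); $g_{\mathcal H}=|\omega_1|^2+|\omega_2|^2$, $g_{\mathcal V}=|\omega_3|^2$. For a nowhere vertical $J$-holomorphic curve, $\varphi^*\mathrm{Sp}(2)$ reduces to the $S^1\times S^1$-bundle cut out by $\omega_2=0$, on which $\tau$ is of type $(1,0)$. The curve is transverse if it is nowhere tangent to $\mathcal H$, nowhere tangent to $\mathcal V$, and this $\tau$ vanishes nowhere. Then $\alpha_-(x)=\|\xi\|_{\mathcal V}/\|\xi\|_{\mathcal H}>0$ for any $0\ne\xi\in T_xX$. Let $Q\subset\varphi^*\mathrm{Sp}(2)$ be the $S^1$-bundle cut out by $\omega_2=0$, $\omega_3=\alpha_-\omega_1$, and for a local section of $Q$ put $$u_1=\frac{\omega_1+\alpha_-\omega_3}{\sqrt{\alpha_-^2+1}},\quad u_2=\frac{\alpha_-\omega_1-\omega_3}{\sqrt{\alpha_-^2+1}},\quad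 u_3=\omega_2,$$ a unitary coframe of $\varphi^*T\mathbb{CP}^3$ with dual frame $(f_1,f_2,f_3)$. Then $f_1$ spans $TX$ and $f_2,f_3$ span the normal bundle $\nu$; the tensor $u_1\otimes f_2$ does not depend on the section of $Q$, so is defined on $X$. $\mathrm{I\!I}$ is the second fundamental form of $X$ with respect to $\overline\nabla$ (equivalently, the Levi-Civita connection): the complex-linear normal component of $\overline\nabla$ on $TX$, viewed as a $\mathrm{Hom}(TX,\nu)$-valued $(1,0)$-form. $d_{\overline\nabla}$ is the exterior covariant derivative for the connection on $\mathrm{Hom}(TX,\nu)$ induced by the tangential and normal projections $\overline\nabla^T,\overline\nabla^\perp$ of $\overline\nabla$; on $\mathrm{I\!I}$ it coincides with $\bar\partial_{\overline\nabla}$. $\mathrm{vol}_{\mathcal H}=\frac i2\omega_1\wedge\overline{\omega_1}$ is the area form of $g_{\mathcal H}$ on $X$. *)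

theory Defs
  imports "HOL-Analysis.Analysis"
begin

section \<open>Smooth functions\<close>

fun C_k_on :: "nat \<Rightarrow> ('a::real_normed_vector \<Rightarrow> 'b::real_normed_vector) \<Rightarrow> 'a set \<Rightarrow> bool" where
  "C_k_on 0 f S \<longleftrightarrow> continuous_on S f"
| "C_k_on (Suc k) f S \<longleftrightarrow>
     (\<forall>x\<in>S. f differentiable (at x)) \<and>
     (\<forall>v. C_k_on k (\<lambda>x. frechet_derivative f (at x) v) S)"

text \<open>Only used for open sets; on an open subset of a Euclidean space this is real
  \<open>C\<^sup>\<infinity>\<close>-smoothness.\<close>

definition smooth_on :: "'a::real_normed_vector set \<Rightarrow> ('a \<Rightarrow> 'b::real_normed_vector) \<Rightarrow> bool" where
  "smooth_on S f \<longleftrightarrow> (\<forall>k. C_k_on k f S)"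


section \<open>Quaternions, \<open>Sp(2)\<close> and \<open>CP\<^sup>3\<close>\<close>

text \<open>The pair \<open>(a, b)\<close> stands for the quaternion \<open>a + j b\<close>, where \<open>a j = j (cnj a)\<close> and
  \<open>j\<^sup>2 = -1\<close>.\<close>

type_synonym quat = "complex \<times> complex"

definition qmul :: "quat \<Rightarrow> quat \<Rightarrow> quat" where
  "qmul p q = (fst p * fst q - cnj (snd p) * snd q, cnj (fst p) * snd q + snd p * fst q)"

definition qcnj :: "quat \<Rightarrow> quat" where
  "qcnj p = (cnj (fst p), - snd p)"

definition qmat_mul :: "quat^2^2 \<Rightarrow> quat^2^2 \<Rightarrow> quat^2^2" where
  "qmat_mul A B = (\<chi> i k. \<Sum>l\<in>UNIV. qmul (A $ i $ l) (B $ l $ k))"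

definition qmat_vec :: "quat^2^2 \<Rightarrow> quat^2 \<Rightarrow> quat^2" where
  "qmat_vec A x = (\<chi> i. \<Sum>l\<in>UNIV. qmul (A $ i $ l) (x $ l))"

definition qmat_adj :: "quat^2^2 \<Rightarrow> quat^2^2" where
  "qmat_adj A = (\<chi> i k. qcnj (A $ k $ i))"

definition qmat_one :: "quat^2^2" where
  "qmat_one = (\<chi> i k. if i = k then (1, 0) else 0)"

definition Sp2 :: "(quat^2^2) set" where
  "Sp2 = {A. qmat_mul (qmat_adj A) A = qmat_one}"

text \<open>The complex structure of \<open>\<complex>\<^sup>4\<close> is right multiplication by complex numbers on
  \<open>\<H>\<^sup>2\<close>, because \<open>(z + j w) c = z c + j (w c)\<close>.\<close>

definition H2_to_C4 :: "quat^2 \<Rightarrow> complex^4" where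
  "H2_to_C4 x = vector [fst (x $ 1), snd (x $ 1), fst (x $ 2), snd (x $ 2)]"

definition cline :: "complex^4 \<Rightarrow> (complex^4) set" where
  "cline v = range (\<lambda>c. c *s v)"

definition CP3 :: "(complex^4) set set" where
  "CP3 = cline ` (UNIV - {0})"

text \<open>The projection \<open>g \<mapsto> g \<cdot> [1,0,0,0]\<close>.\<close>

definition Sp2_proj :: "quat^2^2 \<Rightarrow> (complex^4) set" where
  "Sp2_proj g = cline (H2_to_C4 (qmat_vec g (vector [(1, 0), 0])))"


section \<open>Riemann surfaces and lifts to \<open>Sp(2)\<close>\<close>

type_synonym 'x atlas = "('x set \<times> ('x \<Rightarrow> complex)) set"

text \<open>Neither connectedness nor second countability is required.\<close>

definition riemann_surface :: "'x::t2_space atlas \<Rightarrow> bool" where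
  "riemann_surface A \<longleftrightarrow>
     (\<Union>(U, c)\<in>A. U) = UNIV \<and>
     (\<forall>(U, c)\<in>A. open U \<and> open (c ` U) \<and> homeomorphism U (c ` U) c (inv_into U c)) \<and>
     (\<forall>(U, c)\<in>A. \<forall>(V, d)\<in>A. (d \<circ> inv_into U c) holomorphic_on c ` (U \<inter> V))"

text \<open>Smoothness of a map into \<open>CP\<^sup>3\<close>: locally it is the class of a smooth map into
  \<open>\<complex>\<^sup>4 - {0}\<close>.\<close>

definition smooth_into_CP3 :: "'x::t2_space atlas \<Rightarrow> ('x \<Rightarrow> (complex^4) set) \<Rightarrow> bool" where
  "smooth_into_CP3 A \<phi> \<longleftrightarrow>
     (\<forall>x. \<phi> x \<in> CP3) \<and>
     (\<forall>(U, c)\<in>A. \<forall>x\<in>U. \<exists>W F. open W \<and> c x \<in> W \<and> W \<subseteq> c ` U \<and> smooth_on W F \<and>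
        (\<forall>z\<in>W. F z \<noteq> 0 \<and> \<phi> (inv_into U c z) = cline (F z)))"

text \<open>A local section of \<open>\<phi>\<^sup>*Sp(2)\<close>, written in the coordinate \<open>z = c x\<close> of a chart. All
  geometric objects on the surface below are likewise expressed in such a coordinate, with
  tangent vectors of the surface represented by complex numbers.\<close>

definition local_section ::
  "'x::t2_space atlas \<Rightarrow> ('x \<Rightarrow> (complex^4) set) \<Rightarrow> 'x set \<Rightarrow> ('x \<Rightarrow> complex) \<Rightarrow>
   complex set \<Rightarrow> (complex \<Rightarrow> quat^2^2) \<Rightarrow> bool" where
  "local_section A \<phi> U c W s \<longleftrightarrow>
     (U, c) \<in> A \<and> open W \<and> W \<subseteq> c ` U \<and> smooth_on W s \<and>
     (\<forall>z\<in>W. s z \<in> Sp2 \<and> Sp2_proj (s z) = \<phi> (inv_into U c z))"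


section \<open>The Maurer--Cartan form\<close>

text \<open>The pull-back \<open>s\<^sup>*\<Omega> = s\<^sup>-\<^sup>1 ds\<close> at the point \<open>z\<close>, evaluated on the tangent vector
  \<open>v\<close>. Lemma \<open>mc_matrix\<close> below gives the whole matrix in terms of the forms read off here.\<close>

definition mc :: "(complex \<Rightarrow> quat^2^2) \<Rightarrow> complex \<Rightarrow> complex \<Rightarrow> quat^2^2" where
  "mc s z v = qmat_mul (qmat_adj (s z)) (frechet_derivative s (at z) v)"

definition \<omega>1 :: "(complex \<Rightarrow> quat^2^2) \<Rightarrow> complex \<Rightarrow> complex \<Rightarrow> complex" where
  "\<omega>1 s z v = complex_of_real (sqrt 2) * fst (mc s z v $ 2 $ 1)"

definition \<omega>2 :: "(complex \<Rightarrow> quat^2^2) \<Rightarrow> complex \<Rightarrow> complex \<Rightarrow> complex" where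
  "\<omega>2 s z v = complex_of_real (sqrt 2) * snd (mc s z v $ 2 $ 1)"

definition \<omega>3 :: "(complex \<Rightarrow> quat^2^2) \<Rightarrow> complex \<Rightarrow> complex \<Rightarrow> complex" where
  "\<omega>3 s z v = cnj (snd (mc s z v $ 1 $ 1))"

definition \<tau> :: "(complex \<Rightarrow> quat^2^2) \<Rightarrow> complex \<Rightarrow> complex \<Rightarrow> complex" where
  "\<tau> s z v = snd (mc s z v $ 2 $ 2)"

definition \<rho>1 :: "(complex \<Rightarrow> quat^2^2) \<Rightarrow> complex \<Rightarrow> complex \<Rightarrow> real" where
  "\<rho>1 s z v = Im (fst (mc s z v $ 1 $ 1))"

definition \<rho>2 :: "(complex \<Rightarrow> quat^2^2) \<Rightarrow> complex \<Rightarrow> complex \<Rightarrow> real" where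
  "\<rho>2 s z v = Im (fst (mc s z v $ 2 $ 2))"

lemma qmul_linear:
  "qmul p (q + r) = qmul p q + qmul p r" "qmul (p + q) r = qmul p r + qmul q r"
  "qmul p (a *\<^sub>R q) = a *\<^sub>R qmul p q" "qmul (a *\<^sub>R p) q = a *\<^sub>R qmul p q"
  "qcnj (p + q) = qcnj p + qcnj q" "qcnj (a *\<^sub>R p) = a *\<^sub>R qcnj p"
  by (simp_all add: qmul_def qcnj_def prod_eq_iff algebra_simps)

lemma qcnj_qmul: "qcnj (qmul p q) = qmul (qcnj q) (qcnj p)" and qcnj_qcnj: "qcnj (qcnj p) = p"
  by (simp_all add: qmul_def qcnj_def algebra_simps)

lemma linear_qmat_mul_adj_right: "linear (\<lambda>C. qmat_mul (qmat_adj A) C)"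
  by (rule linearI)
     (simp_all add: qmat_mul_def vec_eq_iff qmul_linear sum.distrib scaleR_sum_right)

lemma linear_qmat_mul_adj_left: "linear (\<lambda>A. qmat_mul (qmat_adj A) C)"
  by (rule linearI)
     (simp_all add: qmat_mul_def qmat_adj_def vec_eq_iff qmul_linear sum.distrib scaleR_sum_right)

lemma mc_matrix:
  assumes W: "open W" "z \<in> W" and Sp: "\<And>y. y \<in> W \<Longrightarrow> s y \<in> Sp2"
    and diff: "s differentiable (at z)"
  defines "r \<equiv> complex_of_real (sqrt 2)"
  shows "mc s z v = vector
    [vector [(\<i> * of_real (\<rho>1 s z v), cnj (\<omega>3 s z v)), (- cnj (\<omega>1 s z v) / r, \<omega>2 s z v / r)],
     vector [(\<omega>1 s z v / r, \<omega>2 s z v / r), (\<i> * of_real (\<rho>2 s z v), \<tau> s z v)]]"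
proof -
  let ?B = "\<lambda>A C. qmat_mul (qmat_adj A) C"
  let ?D = "frechet_derivative s (at z)"
  have bb: "bounded_bilinear ?B"
    by (simp add: bilinear_conv_bounded_bilinear [symmetric] bilinear_def
        linear_qmat_mul_adj_right linear_qmat_mul_adj_left)
  have sD: "(s has_derivative ?D) (at z)"
    using diff by (simp add: frechet_derivative_works)
  have "((\<lambda>y. ?B (s y) (s y)) has_derivative (\<lambda>h. ?B (s z) (?D h) + ?B (?D h) (s z))) (at z)"
    by (rule bounded_bilinear.FDERIV [OF bb sD sD])
  moreover have "((\<lambda>y. ?B (s y) (s y)) has_derivative (\<lambda>h. 0)) (at z)"
    by (rule has_derivative_transform_within_open [OF _ W, where f = "\<lambda>y. qmat_one"])
       (use Sp in \<open>auto simp: Sp2_def\<close>)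
  ultimately have "?B (s z) (?D v) + ?B (?D v) (s z) = 0"
    by (rule has_derivative_unique [THEN fun_cong])
  moreover have "?B (?D v) (s z) = qmat_adj (mc s z v)"
    by (simp add: mc_def qmat_mul_def qmat_adj_def vec_eq_iff UNIV_2 qmul_linear qcnj_qmul
        qcnj_qcnj)
  ultimately have "mc s z v + qmat_adj (mc s z v) = 0"
    by (simp add: mc_def)
  then have e: "mc s z v $ i $ k + qcnj (mc s z v $ k $ i) = 0" for i k
    by (simp add: vec_eq_iff qmat_adj_def)
  have re: "\<i> * complex_of_real (Im w) = w" if "w + cnj w = 0" for w :: complex
    using that by (simp add: complex_eq_iff)
  have r: "r \<noteq> 0" by (simp add: r_def)
  have d1: "\<i> * of_real (\<rho>1 s z v) = fst (mc s z v $ 1 $ 1)"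
    using e [of 1 1] unfolding \<rho>1_def by (intro re) (simp add: prod_eq_iff qcnj_def)
  have d2: "\<i> * of_real (\<rho>2 s z v) = fst (mc s z v $ 2 $ 2)"
    using e [of 2 2] unfolding \<rho>2_def by (intro re) (simp add: prod_eq_iff qcnj_def)
  have o1: "\<omega>1 s z v / r = fst (mc s z v $ 2 $ 1)" and o2: "\<omega>2 s z v / r = snd (mc s z v $ 2 $ 1)"
    using r by (simp_all add: \<omega>1_def \<omega>2_def r_def)
  have "cnj (\<omega>1 s z v) / r = cnj (\<omega>1 s z v / r)" by (simp add: r_def)
  then have o3: "- cnj (\<omega>1 s z v) / r = fst (mc s z v $ 1 $ 2)"
    using e [of 1 2] by (simp add: o1 prod_eq_iff qcnj_def add_eq_0_iff2)
  have o4: "snd (mc s z v $ 2 $ 1) = snd (mc s z v $ 1 $ 2)"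
    using e [of 1 2] by (simp add: prod_eq_iff qcnj_def)
  show ?thesis
    unfolding d1 d2 o1 o2 o3
    by (simp add: vec_eq_iff forall_2 prod_eq_iff o4 \<omega>3_def \<tau>_def)
qed

section \<open>The nearly Kaehler structure in a frame\<close>

text \<open>A local section \<open>s\<close> trivialises \<open>\<phi>\<^sup>*TCP\<^sup>3\<close> by the frame \<open>(e\<^sub>1, e\<^sub>2, e\<^sub>3)\<close> dual to the
  unitary coframe \<open>(\<omega>\<^sub>1, \<omega>\<^sub>2, \<omega>\<^sub>3)\<close>, so tangent vectors of \<open>CP\<^sup>3\<close> become vectors in
  \<open>\<complex>\<^sup>3\<close>; \<open>J\<close> is multiplication by \<open>\<i>\<close>, and \<open>g\<close> is the real part of \<open>herm\<close>.\<close>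

definition dphi :: "(complex \<Rightarrow> quat^2^2) \<Rightarrow> complex \<Rightarrow> complex \<Rightarrow> complex^3" where
  "dphi s z \<xi> = vector [\<omega>1 s z \<xi>, \<omega>2 s z \<xi>, \<omega>3 s z \<xi>]"

definition herm :: "complex^3 \<Rightarrow> complex^3 \<Rightarrow> complex" where
  "herm x y = (\<Sum>a\<in>UNIV. x $ a * cnj (y $ a))"

definition norm_H :: "complex^3 \<Rightarrow> real" where
  "norm_H w = sqrt ((cmod (w $ 1))\<^sup>2 + (cmod (w $ 2))\<^sup>2)"

definition norm_V :: "complex^3 \<Rightarrow> real" where
  "norm_V w = cmod (w $ 3)"

definition horizontal :: "(complex^3) set" where
  "horizontal = {w. w $ 3 = 0}"

definition vertical :: "(complex^3) set" where
  "vertical = {w. w $ 1 = 0 \<and> w $ 2 = 0}"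

definition \<kappa> :: "(complex \<Rightarrow> quat^2^2) \<Rightarrow> complex \<Rightarrow> complex \<Rightarrow> complex^3^3" where
  "\<kappa> s z v = vector
     [vector [\<i> * of_real (\<rho>2 s z v - \<rho>1 s z v), - cnj (\<tau> s z v), 0],
      vector [\<tau> s z v, - \<i> * of_real (\<rho>1 s z v + \<rho>2 s z v), 0],
      vector [0, 0, 2 * \<i> * of_real (\<rho>1 s z v)]]"

text \<open>The nearly Kaehler connection on sections \<open>\<sigma> = \<Sum>\<^sub>a \<sigma>\<^sub>a e\<^sub>a\<close> of \<open>\<phi>\<^sup>*TCP\<^sup>3\<close>, from
  \<open>\<nabla> e\<^sub>b = \<Sum>\<^sub>a \<kappa>\<^sub>a\<^sub>b e\<^sub>a\<close>.\<close>

definition nabla ::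
  "(complex \<Rightarrow> quat^2^2) \<Rightarrow> (complex \<Rightarrow> complex^3) \<Rightarrow> complex \<Rightarrow> complex \<Rightarrow> complex^3" where
  "nabla s \<sigma> z v = frechet_derivative \<sigma> (at z) v + \<kappa> s z v *v \<sigma> z"


section \<open>Transverse \<open>J\<close>-holomorphic curves\<close>

text \<open>\<open>J\<close>-holomorphicity is \<open>d\<phi> \<circ> j = J \<circ> d\<phi>\<close>.\<close>

definition J_holomorphic_curve :: "'x::t2_space atlas \<Rightarrow> ('x \<Rightarrow> (complex^4) set) \<Rightarrow> bool" where
  "J_holomorphic_curve A \<phi> \<longleftrightarrow>
     smooth_into_CP3 A \<phi> \<and>
     (\<forall>U c W s. local_section A \<phi> U c W s \<longrightarrow>
        (\<forall>z\<in>W. \<forall>\<xi>. dphi s z (\<i> * \<xi>) = \<i> *s dphi s z \<xi>))"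

definition transverse_curve :: "'x::t2_space atlas \<Rightarrow> ('x \<Rightarrow> (complex^4) set) \<Rightarrow> bool" where
  "transverse_curve A \<phi> \<longleftrightarrow>
     J_holomorphic_curve A \<phi> \<and>
     (\<forall>U c W s. local_section A \<phi> U c W s \<longrightarrow>
        (\<forall>z\<in>W. \<forall>\<xi>. \<xi> \<noteq> 0 \<longrightarrow> dphi s z \<xi> \<notin> horizontal \<and> dphi s z \<xi> \<notin> vertical)) \<and>
     (\<forall>U c W s. local_section A \<phi> U c W s \<and> (\<forall>z\<in>W. \<forall>\<xi>. \<omega>2 s z \<xi> = 0) \<longrightarrow>
        (\<forall>z\<in>W. \<exists>\<xi>. \<tau> s z \<xi> \<noteq> 0))"

text \<open>The function \<open>\<alpha>\<^sub>-\<close>: the quotient of the vertical and the horizontal norm does not depend on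
  the chart, the section, or the tangent vector.\<close>

definition angle_function :: "'x::t2_space atlas \<Rightarrow> ('x \<Rightarrow> (complex^4) set) \<Rightarrow> 'x \<Rightarrow> real" where
  "angle_function A \<phi> x =
     (THE r. \<forall>U c W s. local_section A \<phi> U c W s \<and> x \<in> U \<and> c x \<in> W \<longrightarrow>
        (\<forall>\<xi>. \<xi> \<noteq> 0 \<longrightarrow> r = norm_V (dphi s (c x) \<xi>) / norm_H (dphi s (c x) \<xi>)))"

text \<open>Local sections of the \<open>S\<^sup>1\<close>-bundle \<open>Q\<close>.\<close>

definition Q_section ::
  "'x::t2_space atlas \<Rightarrow> ('x \<Rightarrow> (complex^4) set) \<Rightarrow> 'x set \<Rightarrow> ('x \<Rightarrow> complex) \<Rightarrow>
   complex set \<Rightarrow> (complex \<Rightarrow> quat^2^2) \<Rightarrow> bool" where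
  "Q_section A \<phi> U c W s \<longleftrightarrow>
     local_section A \<phi> U c W s \<and>
     (\<forall>z\<in>W. \<forall>\<xi>. \<omega>2 s z \<xi> = 0 \<and>
        \<omega>3 s z \<xi> = of_real (angle_function A \<phi> (inv_into U c z)) * \<omega>1 s z \<xi>)"

text \<open>For a section of \<open>Q\<close>, with \<open>a\<close> the value of \<open>\<alpha>\<^sub>-\<close>: the coframe \<open>u\<close> as functionals on
  \<open>\<complex>\<^sup>3\<close>, and the components of its dual frame \<open>f\<close> with respect to \<open>(e\<^sub>1, e\<^sub>2, e\<^sub>3)\<close>.\<close>

definition u_coframe :: "real \<Rightarrow> 3 \<Rightarrow> complex^3 \<Rightarrow> complex" where
  "u_coframe a k w =
     (if k = 1 then (w $ 1 + of_real a * w $ 3) / of_real (sqrt (a\<^sup>2 + 1))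
      else if k = 2 then (of_real a * w $ 1 - w $ 3) / of_real (sqrt (a\<^sup>2 + 1))
      else w $ 2)"

definition f_frame :: "real \<Rightarrow> 3 \<Rightarrow> complex^3" where
  "f_frame a k =
     (if k = 1 then vector [1 / of_real (sqrt (a\<^sup>2 + 1)), 0, of_real a / of_real (sqrt (a\<^sup>2 + 1))]
      else if k = 2 then vector [of_real a / of_real (sqrt (a\<^sup>2 + 1)), 0, - 1 / of_real (sqrt (a\<^sup>2 + 1))]
      else vector [0, 1, 0])"

lemma u_coframe_f_frame: "u_coframe a k (f_frame a l) = (if k = l then 1 else 0)"
proof -
  define r where "r = complex_of_real (sqrt (a\<^sup>2 + 1))"
  have rr: "r * r = of_real a * of_real a + 1"
    by (simp add: r_def power2_eq_square flip: of_real_mult)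
  have r: "r \<noteq> 0"
    by (simp add: r_def add_nonneg_eq_0_iff)
  have nz: "complex_of_real a * of_real a + 1 \<noteq> 0"
    using r rr by (metis mult_eq_0_iff)
  have "(1 / r + of_real a * (of_real a / r)) / r = 1" "(of_real a * (of_real a / r) + 1 / r) / r = 1"
    using r nz by (simp_all add: divide_simps rr)
  then show ?thesis
    using exhaust_3 [of k] exhaust_3 [of l]
    by (auto simp: u_coframe_def f_frame_def r_def [symmetric])
qed
definition vol_H :: "(complex \<Rightarrow> quat^2^2) \<Rightarrow> complex \<Rightarrow> complex \<Rightarrow> complex \<Rightarrow> complex" where
  "vol_H s z v w = \<i> / 2 * (\<omega>1 s z v * cnj (\<omega>1 s z w) - \<omega>1 s z w * cnj (\<omega>1 s z v))"


section \<open>The second fundamental form\<close>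

text \<open>Orthogonal projections of \<open>\<phi>\<^sup>*TCP\<^sup>3\<close> to \<open>TX\<close> (whose vectors are complex numbers, embedded
  by \<open>dphi\<close>) and to the normal bundle. For a \<open>J\<close>-holomorphic immersion, \<open>dphi s z\<close> is complex
  linear and its image is the complex line spanned by \<open>dphi s z 1\<close>.\<close>

definition tang_part :: "(complex \<Rightarrow> quat^2^2) \<Rightarrow> complex \<Rightarrow> complex^3 \<Rightarrow> complex" where
  "tang_part s z w = herm w (dphi s z 1) / herm (dphi s z 1) (dphi s z 1)"

definition norm_part :: "(complex \<Rightarrow> quat^2^2) \<Rightarrow> complex \<Rightarrow> complex^3 \<Rightarrow> complex^3" where
  "norm_part s z w = w - dphi s z (tang_part s z w)"

definition nabla_T ::
  "(complex \<Rightarrow> quat^2^2) \<Rightarrow> (complex \<Rightarrow> complex) \<Rightarrow> complex \<Rightarrow> complex \<Rightarrow> complex" where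
  "nabla_T s Y z v = tang_part s z (nabla s (\<lambda>y. dphi s y (Y y)) z v)"

definition nabla_N ::
  "(complex \<Rightarrow> quat^2^2) \<Rightarrow> (complex \<Rightarrow> complex^3) \<Rightarrow> complex \<Rightarrow> complex \<Rightarrow> complex^3" where
  "nabla_N s \<sigma> z v = norm_part s z (nabla s \<sigma> z v)"

text \<open>\<open>II s z v \<xi>\<close> is the value of the one-form on \<open>v\<close>, applied to \<open>\<xi>\<close>. It is tensorial in
  \<open>\<xi>\<close>, which is extended as a constant vector field of the coordinate domain.\<close>

definition II :: "(complex \<Rightarrow> quat^2^2) \<Rightarrow> complex \<Rightarrow> complex \<Rightarrow> complex \<Rightarrow> complex^3" where
  "II s z v \<xi> = norm_part s z (nabla s (\<lambda>y. dphi s y \<xi>) z v)"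

text \<open>The connection induced on \<open>Hom(TX, \<nu>)\<close>, and the exterior covariant derivative
  \<open>(d\<^sub>\<nabla> B)(v, w) = \<nabla>\<^sub>v (B w) - \<nabla>\<^sub>w (B v) - B [v, w]\<close>, where the constant vector fields \<open>v\<close> and
  \<open>w\<close> commute.\<close>

definition nabla_Hom ::
  "(complex \<Rightarrow> quat^2^2) \<Rightarrow> (complex \<Rightarrow> complex \<Rightarrow> complex^3) \<Rightarrow>
   complex \<Rightarrow> complex \<Rightarrow> complex \<Rightarrow> complex^3" where
  "nabla_Hom s B z v \<xi> = nabla_N s (\<lambda>y. B y \<xi>) z v - B z (nabla_T s (\<lambda>y. \<xi>) z v)"

definition d_nabla ::
  "(complex \<Rightarrow> quat^2^2) \<Rightarrow> (complex \<Rightarrow> complex \<Rightarrow> complex \<Rightarrow> complex^3) \<Rightarrow>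
   complex \<Rightarrow> complex \<Rightarrow> complex \<Rightarrow> complex \<Rightarrow> complex^3" where
  "d_nabla s B z v w \<xi> =
     nabla_Hom s (\<lambda>y. B y w) z v \<xi> - nabla_Hom s (\<lambda>y. B y v) z w \<xi>"

definition holomorphic_II :: "'x::t2_space atlas \<Rightarrow> ('x \<Rightarrow> (complex^4) set) \<Rightarrow> bool" where
  "holomorphic_II A \<phi> \<longleftrightarrow>
     (\<forall>U c W s. local_section A \<phi> U c W s \<longrightarrow>
        (\<forall>z\<in>W. \<forall>v w \<xi>. d_nabla s (II s) z v w \<xi> = 0))"

end

theory Submission
  imports Defs
begin

text \<open>
  Pulling the Maurer--Cartan equation back to a lift \<open>s\<close> with \<open>\<omega>\<^sub>2 = 0\<close> and \<open>\<omega>\<^sub>3 = \<alpha> \<omega>\<^sub>1\<close> gives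
  the structure equations
  \<open>d\<omega>\<^sub>1 = -i (\<rho>\<^sub>2 - \<rho>\<^sub>1) \<and> \<omega>\<^sub>1\<close>, \<open>d\<tau> = 2i \<rho>\<^sub>2 \<and> \<tau>\<close> and, for \<open>\<sigma> = \<rho>\<^sub>2 - 3 \<rho>\<^sub>1\<close>,
  \<open>i d\<sigma> = (2 - 3\<alpha>\<^sup>2) \<omega>\<^sub>1 \<and> cnj \<omega>\<^sub>1 - \<tau> \<and> cnj \<tau>\<close>;
  moreover \<open>\<tau>\<close> and \<open>\<theta> = d\<alpha> - i\<alpha>\<sigma>\<close> are of type \<open>(1,0)\<close>. With \<open>r = sqrt (\<alpha>\<^sup>2 + 1)\<close>, the second
  fundamental form is \<open>\<omega>\<^sub>1 \<otimes> (\<tau> f\<^sub>3 - (\<theta> / r) f\<^sub>2)\<close>. In its covariant exterior derivative the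
  \<open>f\<^sub>3\<close>-component is a multiple of \<open>\<theta> \<and> \<tau> = 0\<close>, and in the \<open>f\<^sub>2\<close>-component everything cancels
  except the curvature term \<open>(2 - 3\<alpha>\<^sup>2) \<omega>\<^sub>1 \<and> cnj \<omega>\<^sub>1\<close> of \<open>d\<sigma>\<close>.

  If the second fundamental form is holomorphic, then \<open>\<alpha>\<^sup>2 = 2/3\<close> is constant, so
  \<open>\<theta> = -i\<alpha>\<sigma>\<close> is an imaginary form of type \<open>(1,0)\<close> and hence zero; then \<open>d\<sigma> = 0\<close> forces
  \<open>\<tau> = 0\<close>, against transversality.

  An adapted lift is obtained from any lift by acting on the second column with a unit quaternion: the
  entry \<open>\<omega>\<^sub>1 + j \<omega>\<^sub>2\<close> of the Maurer--Cartan form can be rotated into \<open>\<complex>\<close> with any prescribed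
  phase, and the phase of \<open>\<omega>\<^sub>3\<close> makes \<open>\<omega>\<^sub>3 / \<omega>\<^sub>1\<close> positive.
\<close>

section \<open>Calculus of smooth functions\<close>

lemma frechet_derivative_eqI:
  "(f has_derivative f') (at x) \<Longrightarrow> frechet_derivative f (at x) = f'"
  using frechet_derivative_at by metis

text \<open>On an open set, agreement of values is agreement near each point, so all derivatives
  agree as well.\<close>

lemma C_k_on_cong:
  assumes "open S" "\<And>x. x \<in> S \<Longrightarrow> f x = g x" "C_k_on k f S"
  shows "C_k_on k g S"
  using assms(2,3)
proof (induction k arbitrary: f g)
  case 0
  then show ?case by (simp cong: continuous_on_cong)
next
  case (Suc k)
  have d: "(g has_derivative frechet_derivative f (at x)) (at x)" if "x \<in> S" for x
    by (rule has_derivative_transform_within_open [OF _ assms(1) that Suc.prems(1)])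
       (use Suc.prems(2) that in \<open>auto simp: frechet_derivative_works [symmetric]\<close>)
  then have e: "frechet_derivative f (at x) = frechet_derivative g (at x)" if "x \<in> S" for x
    using that frechet_derivative_at by blast
  have "C_k_on k (\<lambda>x. frechet_derivative g (at x) v) S" for v
    by (rule Suc.IH [of "\<lambda>x. frechet_derivative f (at x) v"]) (use e Suc.prems(2) in auto)
  then show ?case using d by (auto simp: differentiable_def)
qed

text \<open>\<open>C_k_on\<close> refers to the chosen \<open>frechet_derivative\<close>; this rule
  lets an explicit derivative \<open>f'\<close> take its place, so that the closure properties below
  follow by induction on \<open>k\<close> from the differentiation rules.\<close>

lemma C_k_on_SucI:
  assumes "open S" "\<And>x. x \<in> S \<Longrightarrow> (f has_derivative f' x) (at x)"
    "\<And>v. C_k_on k (\<lambda>x. f' x v) S"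
  shows "C_k_on (Suc k) f S"
proof -
  have "C_k_on k (\<lambda>x. frechet_derivative f (at x) v) S" for v
    by (rule C_k_on_cong [OF assms(1) _ assms(3)])
       (use frechet_derivative_eqI [OF assms(2)] in auto)
  then show ?thesis using assms(2) by (auto simp: differentiable_def)
qed

lemma C_k_on_SucD:
  assumes "C_k_on (Suc k) f S"
  shows "\<And>x. x \<in> S \<Longrightarrow> (f has_derivative frechet_derivative f (at x)) (at x)"
    "\<And>v. C_k_on k (\<lambda>x. frechet_derivative f (at x) v) S"
  using assms by (auto simp: frechet_derivative_works [symmetric])

lemma C_k_on_decrease: "C_k_on (Suc k) f S \<Longrightarrow> C_k_on k f S"
proof (induction k arbitrary: f)
  case 0
  then show ?case
    by (auto intro!: continuous_at_imp_continuous_on differentiable_imp_continuous_within)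
next
  case (Suc k)
  then show ?case by (metis C_k_on.simps(2))
qed

lemma C_k_on_const: "C_k_on k (\<lambda>x. c) S"
  by (induction k arbitrary: c) auto

lemma C_k_on_add:
  assumes "open S" "C_k_on k f S" "C_k_on k g S"
  shows "C_k_on k (\<lambda>x. f x + g x) S"
  using assms(2,3)
proof (induction k arbitrary: f g)
  case 0
  then show ?case by (simp add: continuous_on_add)
next
  case (Suc k)
  note f = C_k_on_SucD [OF Suc.prems(1)] and g = C_k_on_SucD [OF Suc.prems(2)]
  show ?case
    by (rule C_k_on_SucI [OF assms(1) has_derivative_add [OF f(1) g(1)]])
       (use f g Suc.IH in auto)
qed

lemma C_k_on_linear:
  assumes "bounded_linear L" "open S" "C_k_on k f S"
  shows "C_k_on k (\<lambda>x. L (f x)) S"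
  using assms(3)
proof (induction k arbitrary: f)
  case 0
  then show ?case by (simp add: bounded_linear.continuous_on [OF assms(1)])
next
  case (Suc k)
  note f = C_k_on_SucD [OF Suc.prems(1)]
  show ?case
    by (rule C_k_on_SucI [OF assms(2) bounded_linear.has_derivative [OF assms(1) f(1)]])
       (use f Suc.IH in auto)
qed

lemma C_k_on_bilinear:
  assumes "bounded_bilinear B" "open S" "C_k_on k f S" "C_k_on k g S"
  shows "C_k_on k (\<lambda>x. B (f x) (g x)) S"
  using assms(3,4)
proof (induction k arbitrary: f g)
  case 0
  then show ?case by (simp add: bounded_bilinear.continuous_on [OF assms(1)])
next
  case (Suc k)
  note f = C_k_on_SucD [OF Suc.prems(1)] and g = C_k_on_SucD [OF Suc.prems(2)]
  \<comment> \<open>By the Leibniz rule each term keeps one undifferentiated factor, whose order has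
    to be lowered from \<open>Suc k\<close> to \<open>k\<close> before the induction hypothesis
    applies.\<close>
  have "C_k_on k (\<lambda>x. B (f x) (frechet_derivative g (at x) v)) S"
    "C_k_on k (\<lambda>x. B (frechet_derivative f (at x) v) (g x)) S" for v
    using Suc.IH [OF C_k_on_decrease [OF Suc.prems(1)] g(2)]
      Suc.IH [OF f(2) C_k_on_decrease [OF Suc.prems(2)]] by simp_all
  then show ?case
    by (intro C_k_on_SucI [OF assms(2) bounded_bilinear.FDERIV [OF assms(1) f(1) g(1)]]
        C_k_on_add assms(2))
qed

lemma C_k_on_mult:
  fixes f g :: "'a::real_normed_vector \<Rightarrow> 'b::real_normed_algebra"
  assumes "open S" "C_k_on k f S" "C_k_on k g S"
  shows "C_k_on k (\<lambda>x. f x * g x) S"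
  by (rule C_k_on_bilinear [OF bounded_bilinear_mult assms])

text \<open>The derivative of \<open>1/f\<close> is a polynomial in \<open>1/f\<close> and the
  derivative of \<open>f\<close>, so regularity of order \<open>k\<close> for \<open>1/f\<close>
  bootstraps to order \<open>Suc k\<close>.\<close>

lemma C_k_on_inverse:
  fixes f :: "'a::real_normed_vector \<Rightarrow> 'b::real_normed_field"
  assumes "open S" "\<And>x. x \<in> S \<Longrightarrow> f x \<noteq> 0" "C_k_on k f S"
  shows "C_k_on k (\<lambda>x. inverse (f x)) S"
  using assms(3)
proof (induction k)
  case 0
  then show ?case using assms(2) by (auto intro!: continuous_on_inverse)
next
  case (Suc k)
  note f = C_k_on_SucD [OF Suc.prems(1)]
  have i: "C_k_on k (\<lambda>x. inverse (f x)) S"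
    using Suc C_k_on_decrease by blast
  have "C_k_on k (\<lambda>x. - (inverse (f x) * frechet_derivative f (at x) v * inverse (f x))) S" for v
    by (intro C_k_on_linear [OF bounded_linear_minus [OF bounded_linear_ident] assms(1)]
        C_k_on_mult assms(1) i f)
  then show ?case
    by (intro C_k_on_SucI [OF assms(1) Deriv.has_derivative_inverse [OF assms(2) f(1)]])
qed

text \<open>The derivative \<open>f' / (2 sqrt f)\<close> contains only \<open>f'\<close> and the
  root itself, so the induction runs as for \<open>C_k_on_inverse\<close>; positivity keeps the
  argument away from the singularity of the root at 0.\<close>

lemma C_k_on_sqrt:
  assumes "open S" "\<And>x. x \<in> S \<Longrightarrow> f x > 0" "C_k_on k f S"
  shows "C_k_on k (\<lambda>x. sqrt (f x)) S"
  using assms(3)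
proof (induction k)
  case 0
  then show ?case using assms(2) by (auto intro!: continuous_on_real_sqrt)
next
  case (Suc k)
  note f = C_k_on_SucD [OF Suc.prems(1)]
  have "C_k_on k (\<lambda>x. sqrt (f x)) S"
    using Suc C_k_on_decrease by blast
  then have i: "C_k_on k (\<lambda>x. inverse (sqrt (f x))) S"
    by (rule C_k_on_inverse [OF assms(1), rotated]) (use assms(2) in force)
  have "C_k_on k (\<lambda>x. frechet_derivative f (at x) v * (inverse (sqrt (f x)) * (1/2))) S" for v
    by (intro C_k_on_mult assms(1) i f C_k_on_const)
  then show ?case
    by (intro C_k_on_SucI [OF assms(1) has_derivative_real_sqrt [OF assms(2) f(1)]])
       (simp_all add: divide_simps)
qed

lemma smooth_on_D:
  "smooth_on S f \<Longrightarrow> smooth_on S (\<lambda>x. frechet_derivative f (at x) v)"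
  unfolding smooth_on_def by (metis C_k_on.simps(2))

lemma smooth_on_has_derivative:
  "smooth_on S f \<Longrightarrow> x \<in> S \<Longrightarrow> (f has_derivative frechet_derivative f (at x)) (at x)"
  unfolding smooth_on_def by (metis C_k_on_SucD(1))

lemma smooth_on_differentiable: "smooth_on S f \<Longrightarrow> x \<in> S \<Longrightarrow> f differentiable (at x)"
  using smooth_on_has_derivative differentiable_def by blast

lemma smooth_on_continuous: "smooth_on S f \<Longrightarrow> continuous_on S f"
  unfolding smooth_on_def by (metis C_k_on.simps(1))

lemma smooth_on_cong:
  "open S \<Longrightarrow> (\<And>x. x \<in> S \<Longrightarrow> f x = g x) \<Longrightarrow> smooth_on S f \<Longrightarrow> smooth_on S g"
  unfolding smooth_on_def using C_k_on_cong by blast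

lemma C_k_on_subset: "C_k_on k f S \<Longrightarrow> T \<subseteq> S \<Longrightarrow> C_k_on k f T"
  by (induction k arbitrary: f) (auto intro: continuous_on_subset)

lemma smooth_on_subset: "smooth_on S f \<Longrightarrow> T \<subseteq> S \<Longrightarrow> smooth_on T f"
  unfolding smooth_on_def using C_k_on_subset by blast

lemma smooth_on_const: "smooth_on S (\<lambda>x. c)"
  unfolding smooth_on_def using C_k_on_const by blast

lemma smooth_on_add:
  "open S \<Longrightarrow> smooth_on S f \<Longrightarrow> smooth_on S g \<Longrightarrow> smooth_on S (\<lambda>x. f x + g x)"
  unfolding smooth_on_def using C_k_on_add by blast

lemma smooth_on_linear:
  "bounded_linear L \<Longrightarrow> open S \<Longrightarrow> smooth_on S f \<Longrightarrow> smooth_on S (\<lambda>x. L (f x))"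
  unfolding smooth_on_def using C_k_on_linear by blast

lemma smooth_on_bilinear:
  "bounded_bilinear B \<Longrightarrow> open S \<Longrightarrow> smooth_on S f \<Longrightarrow> smooth_on S g
    \<Longrightarrow> smooth_on S (\<lambda>x. B (f x) (g x))"
  unfolding smooth_on_def using C_k_on_bilinear by blast

lemma smooth_on_inverse:
  fixes f :: "'a::real_normed_vector \<Rightarrow> 'b::real_normed_field"
  shows "open S \<Longrightarrow> (\<And>x. x \<in> S \<Longrightarrow> f x \<noteq> 0) \<Longrightarrow> smooth_on S f
    \<Longrightarrow> smooth_on S (\<lambda>x. inverse (f x))"
  unfolding smooth_on_def using C_k_on_inverse by blast

lemma smooth_on_sqrt:
  "open S \<Longrightarrow> (\<And>x. x \<in> S \<Longrightarrow> f x > 0) \<Longrightarrow> smooth_on S f \<Longrightarrow> smooth_on S (\<lambda>x. sqrt (f x))"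
  unfolding smooth_on_def using C_k_on_sqrt by blast

lemmas smooth_on_mult = smooth_on_bilinear [OF bounded_bilinear_mult]
lemmas smooth_on_minus = smooth_on_linear [OF bounded_linear_minus [OF bounded_linear_ident]]
lemmas smooth_on_of_real = smooth_on_linear [OF bounded_linear_of_real]
lemmas smooth_on_fst = smooth_on_linear [OF bounded_linear_fst]
lemmas smooth_on_snd = smooth_on_linear [OF bounded_linear_snd]
lemmas smooth_on_nth = smooth_on_linear [OF bounded_linear_vec_nth]

lemma smooth_on_Pair:
  assumes S: "open S" and f: "smooth_on S f" and g: "smooth_on S g"
  shows "smooth_on S (\<lambda>x. (f x, g x))"
proof -
  have "bounded_linear (\<lambda>a::'b. (a, 0::'c))" "bounded_linear (\<lambda>b::'c. (0::'b, b))"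
    by (intro bounded_linear_Pair bounded_linear_ident bounded_linear_zero)+
  then have "smooth_on S (\<lambda>x. (f x, 0) + (0, g x))"
    by (intro smooth_on_add S) (rule smooth_on_linear [OF _ S]; use f g in blast)+
  then show ?thesis by simp
qed

lemma smooth_on_sum:
  assumes "open S" "\<And>i. i \<in> I \<Longrightarrow> smooth_on S (f i)"
  shows "smooth_on S (\<lambda>x. \<Sum>i\<in>I. f i x)"
  using assms(2)
  by (induction I rule: infinite_finite_induct) (auto simp: smooth_on_const smooth_on_add assms(1))

lemma bounded_linear_axis: "bounded_linear (axis i :: 'b::real_normed_vector \<Rightarrow> 'b ^ 'n::finite)"
proof -
  have "linear (axis i :: 'b \<Rightarrow> 'b ^ 'n)"
    by (rule linearI) (auto simp: axis_def vec_eq_iff)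
  moreover have "norm (axis i x :: 'b ^ 'n) = norm x" for x
    by (simp add: norm_vec_def axis_def L2_set_def if_distrib [of norm] if_distrib [of "\<lambda>x. x ^ 2"]
        cong: if_cong)
  ultimately show ?thesis
    by (intro bounded_linear.intro bounded_linear_axioms.intro) (auto intro!: exI [of _ 1])
qed

lemma smooth_on_vec:
  fixes f :: "'a::real_normed_vector \<Rightarrow> 'n::finite \<Rightarrow> 'b::real_normed_vector"
  assumes "open S" "\<And>i. smooth_on S (\<lambda>x. f x i)"
  shows "smooth_on S (\<lambda>x. \<chi> i. f x i)"
proof -
  have "smooth_on S (\<lambda>x. \<Sum>i\<in>UNIV. axis i (f x i))"
    by (intro smooth_on_sum assms(1)) (rule smooth_on_linear [OF bounded_linear_axis assms(1) assms(2)])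
  moreover have "(\<Sum>i\<in>UNIV. axis i (f x i)) = (\<chi> i. f x i)" for x
    by (simp add: vec_eq_iff axis_def sum.delta)
  ultimately show ?thesis by simp
qed

section \<open>Symmetry of second derivatives\<close>

lemma second_difference:
  fixes f :: "'a::real_normed_vector \<Rightarrow> real"
  assumes sub: "\<And>x y. 0 \<le> x \<Longrightarrow> x \<le> t \<Longrightarrow> 0 \<le> y \<Longrightarrow> y \<le> t \<Longrightarrow> z + x *\<^sub>R v + y *\<^sub>R w \<in> S"
    and S: "C_k_on 2 f S" and t: "t > 0"
  shows "\<exists>x y. 0 \<le> x \<and> x \<le> t \<and> 0 \<le> y \<and> y \<le> t \<and>
    f (z + t *\<^sub>R v + t *\<^sub>R w) - f (z + t *\<^sub>R v) - (f (z + t *\<^sub>R w) - f z) =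
    t * t * frechet_derivative (\<lambda>p. frechet_derivative f (at p) v) (at (z + x *\<^sub>R v + y *\<^sub>R w)) w"
proof -
  let ?D = "\<lambda>p. frechet_derivative f (at p) v"
  have S1: "C_k_on (Suc 1) f S" using S by (simp add: numeral_2_eq_2)
  note f = C_k_on_SucD(1) [OF S1]
  have D: "(?D has_derivative frechet_derivative ?D (at p)) (at p)" if "p \<in> S" for p
    by (rule C_k_on_SucD(1) [OF C_k_on_SucD(2) [OF S1, unfolded One_nat_def] that])
  \<comment> \<open>The second difference over the parallelogram is the increment of
    \<open>\<phi>\<close> over \<open>[0, t]\<close>; the mean value theorem turns it into
    \<open>t\<close> times an increment of the derivative in direction \<open>v\<close>.\<close>
  define \<phi> where "\<phi> x = f (z + x *\<^sub>R v + t *\<^sub>R w) - f (z + x *\<^sub>R v)" for x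
  have "(\<phi> has_real_derivative ?D (z + x *\<^sub>R v + t *\<^sub>R w) - ?D (z + x *\<^sub>R v)) (at x)"
    if "0 \<le> x" "x \<le> t" for x
  proof -
    have 1: "((\<lambda>x. f (z + x *\<^sub>R v + t *\<^sub>R w)) has_derivative
      (\<lambda>h. frechet_derivative f (at (z + x *\<^sub>R v + t *\<^sub>R w)) (h *\<^sub>R v))) (at x)"
      by (rule has_derivative_compose [OF _ f]) (use sub that t in \<open>auto intro!: derivative_eq_intros\<close>)
    have z: "z + x *\<^sub>R v \<in> S" using sub [of x 0] that t by simp
    have 2: "((\<lambda>x. f (z + x *\<^sub>R v)) has_derivative
      (\<lambda>h. frechet_derivative f (at (z + x *\<^sub>R v)) (h *\<^sub>R v))) (at x)"
      by (rule has_derivative_compose [OF _ f]) (use z in \<open>auto intro!: derivative_eq_intros\<close>)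
    have l: "linear (frechet_derivative f (at p))" if "p \<in> S" for p
      using f [OF that] has_derivative_linear by blast
    have zt: "z + x *\<^sub>R v + t *\<^sub>R w \<in> S" using sub [of x t] that t by simp
    show ?thesis
      unfolding \<phi>_def has_field_derivative_def
      by (rule has_derivative_eq_rhs [OF has_derivative_diff [OF 1 2]])
         (simp add: fun_eq_iff linear_scale [OF l [OF zt]] linear_scale [OF l [OF z]]
           right_diff_distrib mult.commute)
  qed
  then obtain x where x: "0 < x" "x < t"
    and \<phi>: "\<phi> t - \<phi> 0 = (t - 0) * (?D (z + x *\<^sub>R v + t *\<^sub>R w) - ?D (z + x *\<^sub>R v))"
    using MVT2 [OF t, of \<phi> "\<lambda>x. ?D (z + x *\<^sub>R v + t *\<^sub>R w) - ?D (z + x *\<^sub>R v)"] by blast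
  \<comment> \<open>A second use of the mean value theorem, now in direction \<open>w\<close> at the
    fixed \<open>x\<close>, supplies the other factor \<open>t\<close>.\<close>
  define \<psi> where "\<psi> y = ?D (z + x *\<^sub>R v + y *\<^sub>R w)" for y
  have "(\<psi> has_real_derivative frechet_derivative ?D (at (z + x *\<^sub>R v + y *\<^sub>R w)) w) (at y)"
    if "0 \<le> y" "y \<le> t" for y
  proof -
    have p: "z + x *\<^sub>R v + y *\<^sub>R w \<in> S" using sub x that by simp
    have 1: "(\<psi> has_derivative
      (\<lambda>h. frechet_derivative ?D (at (z + x *\<^sub>R v + y *\<^sub>R w)) (h *\<^sub>R w))) (at y)"
      unfolding \<psi>_def
      by (rule has_derivative_compose [where g = ?D and f = "\<lambda>y. z + x *\<^sub>R v + y *\<^sub>R w", OF _ D [OF p]])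
         (auto intro!: derivative_eq_intros)
    have l: "linear (frechet_derivative ?D (at (z + x *\<^sub>R v + y *\<^sub>R w)))"
      using D [OF p] has_derivative_linear by blast
    show ?thesis
      unfolding has_field_derivative_def
      by (rule has_derivative_eq_rhs [OF 1]) (auto simp: fun_eq_iff linear_scale [OF l])
  qed
  then obtain y where y: "0 < y" "y < t"
    and \<psi>: "\<psi> t - \<psi> 0 = (t - 0) * frechet_derivative ?D (at (z + x *\<^sub>R v + y *\<^sub>R w)) w"
    using MVT2 [OF t, of \<psi> "\<lambda>y. frechet_derivative ?D (at (z + x *\<^sub>R v + y *\<^sub>R w)) w"] by blast
  have "\<phi> t - \<phi> 0 = t * (\<psi> t - \<psi> 0)" using \<phi> by (simp add: \<psi>_def)
  then show ?thesis
    using x y \<psi> by (intro exI [of _ x] exI [of _ y]) (simp add: \<phi>_def)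
qed

text \<open>The second difference over the parallelogram spanned by \<open>t v\<close> and
  \<open>t w\<close> is symmetric in \<open>v\<close> and \<open>w\<close>. By
  \<open>second_difference\<close> it is \<open>t\<^sup>2\<close> times either mixed derivative at a
  nearby point, and continuity of these derivatives gives equality at \<open>z\<close>.\<close>

lemma second_derivative_symmetric_real:
  fixes f :: "'a::real_normed_vector \<Rightarrow> real"
  assumes "open S" "z \<in> S" "smooth_on S f"
  shows "frechet_derivative (\<lambda>p. frechet_derivative f (at p) v) (at z) w =
    frechet_derivative (\<lambda>p. frechet_derivative f (at p) w) (at z) v"
proof -
  define G where "G v w p = frechet_derivative (\<lambda>p. frechet_derivative f (at p) v) (at p) w"
    for v w p
  have C2: "C_k_on 2 f S" using assms(3) smooth_on_def by blast
  obtain r where r: "r > 0" "ball z r \<subseteq> S" using assms(1,2) open_contains_ball by blast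
  \<comment> \<open>For \<open>t < R\<close> the parallelogram stays inside the ball; the summand 1
    keeps the denominator positive when \<open>v = w = 0\<close>.\<close>
  define R where "R = r / (norm v + norm w + 1)"
  have R: "R > 0" using r by (simp add: R_def add_nonneg_pos)
  have nrm: "norm (x *\<^sub>R v + y *\<^sub>R w) \<le> t * (norm v + norm w + 1)"
    if "0 \<le> x" "x \<le> t" "0 \<le> y" "y \<le> t" for x y t
  proof -
    have "norm (x *\<^sub>R v + y *\<^sub>R w) \<le> x * norm v + y * norm w"
      using that norm_triangle_ineq [of "x *\<^sub>R v" "y *\<^sub>R w"] by simp
    also have "\<dots> \<le> t * norm v + t * norm w"
      using that by (intro add_mono mult_right_mono) auto
    finally show ?thesis using that by (simp add: algebra_simps)
  qed
  have sub: "z + x *\<^sub>R v + y *\<^sub>R w \<in> S"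
    if "0 \<le> x" "x \<le> t" "0 \<le> y" "y \<le> t" "t < R" for x y t
  proof -
    have "norm (x *\<^sub>R v + y *\<^sub>R w) < r"
    proof (rule le_less_trans [OF nrm [OF that(1-4)]])
      have "norm v + norm w + 1 > 0" by (simp add: add_nonneg_pos)
      then show "t * (norm v + norm w + 1) < r"
        using that(5) by (simp add: R_def pos_less_divide_eq)
    qed
    then have "z + x *\<^sub>R v + y *\<^sub>R w \<in> ball z r"
      by (metis add.assoc add_diff_cancel_left' dist_commute dist_norm mem_ball)
    then show ?thesis using r by blast
  qed
  have "\<bar>G v w z - G w v z\<bar> \<le> e" if "e > 0" for e
  proof -
    have c: "continuous_on S (G v w)" "continuous_on S (G w v)"
      unfolding G_def using assms(3) smooth_on_D smooth_on_continuous by blast+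
    have "\<exists>d>0. \<forall>p. dist p z < d \<longrightarrow> p \<in> S \<longrightarrow> dist (G v w p) (G v w z) < e/2"
      "\<exists>d>0. \<forall>p. dist p z < d \<longrightarrow> p \<in> S \<longrightarrow> dist (G w v p) (G w v z) < e/2"
      using c assms(2) that unfolding continuous_on_iff by (metis half_gt_zero)+
    then obtain d1 d2 where d: "d1 > 0" "d2 > 0"
      and d1: "\<And>p. dist p z < d1 \<Longrightarrow> p \<in> S \<Longrightarrow> dist (G v w p) (G v w z) < e/2"
      and d2: "\<And>p. dist p z < d2 \<Longrightarrow> p \<in> S \<Longrightarrow> dist (G w v p) (G w v z) < e/2"
      by blast
    define N where "N = norm v + norm w + 1"
    have N: "N > 0" by (simp add: N_def add_nonneg_pos)
    \<comment> \<open>Halving the minimum makes all three bounds strict.\<close>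
    define t where "t = min R (min (d1 / N) (d2 / N)) / 2"
    have t: "t > 0" "t < R" "t * N < d1" "t * N < d2"
      using R d N by (auto simp: t_def min_def field_simps)
    obtain x y where xy: "0 \<le> x" "x \<le> t" "0 \<le> y" "y \<le> t" and
      1: "f (z + t *\<^sub>R v + t *\<^sub>R w) - f (z + t *\<^sub>R v) - (f (z + t *\<^sub>R w) - f z) =
        t * t * G v w (z + x *\<^sub>R v + y *\<^sub>R w)"
      using second_difference [OF _ C2 t(1), of z v w] sub t(2) unfolding G_def by blast
    have sub': "z + x *\<^sub>R w + y *\<^sub>R v \<in> S"
      if "0 \<le> x" "x \<le> t" "0 \<le> y" "y \<le> t" for x y
      using sub [OF that(3,4,1,2) t(2)] by (simp add: add.assoc add.commute [of "y *\<^sub>R v"])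
    obtain x' y' where xy': "0 \<le> x'" "x' \<le> t" "0 \<le> y'" "y' \<le> t" and
      2: "f (z + t *\<^sub>R w + t *\<^sub>R v) - f (z + t *\<^sub>R w) - (f (z + t *\<^sub>R v) - f z) =
        t * t * G w v (z + x' *\<^sub>R w + y' *\<^sub>R v)"
      using second_difference [OF _ C2 t(1), of z w v] sub' unfolding G_def by blast
    have "G v w (z + x *\<^sub>R v + y *\<^sub>R w) = G w v (z + x' *\<^sub>R w + y' *\<^sub>R v)"
      using 1 2 t(1) by (simp add: algebra_simps)
    moreover have "dist (G v w (z + x *\<^sub>R v + y *\<^sub>R w)) (G v w z) < e/2"
      by (rule d1) (use nrm [OF xy] t sub [OF xy t(2)] in \<open>auto simp: dist_norm N_def add.assoc\<close>)
    moreover have "dist (G w v (z + x' *\<^sub>R w + y' *\<^sub>R v)) (G w v z) < e/2"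
      by (rule d2) (use nrm [OF xy'(3,4,1,2)] t sub' [OF xy'] in
          \<open>auto simp: dist_norm N_def add.assoc add.commute [of "y' *\<^sub>R v"]\<close>)
    ultimately show ?thesis unfolding dist_real_def by linarith
  qed
  then have "G v w z = G w v z" by (metis abs_ge_zero abs_le_zero_iff eq_iff_diff_eq_0 field_le_epsilon add_0 )
  then show ?thesis by (simp add: G_def)
qed

text \<open>Inner products with basis vectors commute with differentiation, which reduces the claim
  to real functions.\<close>

lemma second_derivative_symmetric:
  fixes f :: "'a::real_normed_vector \<Rightarrow> 'b::euclidean_space"
  assumes S: "open S" "z \<in> S" and f: "smooth_on S f"
  shows "frechet_derivative (\<lambda>p. frechet_derivative f (at p) v) (at z) w =
    frechet_derivative (\<lambda>p. frechet_derivative f (at p) w) (at z) v"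
proof (rule euclidean_eqI)
  fix b :: 'b
  have *: "frechet_derivative (\<lambda>p. g p \<bullet> b) (at p) v = frechet_derivative g (at p) v \<bullet> b"
    if "smooth_on S g" "p \<in> S" for g :: "'a \<Rightarrow> 'b" and p v
    using frechet_derivative_eqI [OF bounded_linear.has_derivative [OF bounded_linear_inner_left
        smooth_on_has_derivative [OF that]], of b] by simp
  have **: "frechet_derivative (\<lambda>p. frechet_derivative f (at p) v) (at z) w \<bullet> b =
    frechet_derivative (\<lambda>p. frechet_derivative (\<lambda>p. f p \<bullet> b) (at p) v) (at z) w" for v w
  proof -
    have "frechet_derivative (\<lambda>p. frechet_derivative f (at p) v) (at z) w \<bullet> b =
      frechet_derivative (\<lambda>p. frechet_derivative f (at p) v \<bullet> b) (at z) w"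
      using * smooth_on_D f S by metis
    also have "frechet_derivative (\<lambda>p. frechet_derivative f (at p) v \<bullet> b) (at z) =
      frechet_derivative (\<lambda>p. frechet_derivative (\<lambda>p. f p \<bullet> b) (at p) v) (at z)"
      by (rule frechet_derivative_transform_within_open [OF _ S])
         (use * [OF f] smooth_on_differentiable [OF smooth_on_linear [OF bounded_linear_inner_left
             S(1) smooth_on_D [OF f]] S(2)] in auto)
    finally show ?thesis .
  qed
  show "frechet_derivative (\<lambda>p. frechet_derivative f (at p) v) (at z) w \<bullet> b =
    frechet_derivative (\<lambda>p. frechet_derivative f (at p) w) (at z) v \<bullet> b"
    unfolding **
    by (rule second_derivative_symmetric_real [OF S smooth_on_linear [OF bounded_linear_inner_left S(1) f]])
qed

section \<open>The Maurer--Cartan equation\<close>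

lemma qmul_assoc: "qmul (qmul p q) r = qmul p (qmul q r)"
  by (simp add: qmul_def algebra_simps)

lemma qmat_mul_assoc: "qmat_mul (qmat_mul A B) C = qmat_mul A (qmat_mul B C)"
  by (simp add: qmat_mul_def vec_eq_iff UNIV_2 qmul_linear qmul_assoc)

lemma qmat_mul_one: "qmat_mul A qmat_one = A" "qmat_mul qmat_one A = A"
  by (simp_all add: qmat_mul_def qmat_one_def vec_eq_iff forall_2 UNIV_2 qmul_def prod_eq_iff)

lemma qmat_adj_mul: "qmat_adj (qmat_mul A B) = qmat_mul (qmat_adj B) (qmat_adj A)"
  by (simp add: qmat_mul_def qmat_adj_def vec_eq_iff UNIV_2 qmul_linear qcnj_qmul)

lemma qmat_adj_adj: "qmat_adj (qmat_adj A) = A"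
  by (simp add: qmat_adj_def vec_eq_iff qcnj_qcnj)

lemma qmat_adj_minus: "qmat_mul (- A) B = - qmat_mul A B" "qmat_adj (- A) = - qmat_adj A"
  by (simp_all add: qmat_adj_def qmat_mul_def vec_eq_iff forall_2 UNIV_2 qmul_def qcnj_def
      prod_eq_iff)

lemma Sp2_left: "A \<in> Sp2 \<Longrightarrow> qmat_mul (qmat_adj A) A = qmat_one"
  by (simp add: Sp2_def)

text \<open>The definition of \<open>Sp2\<close> provides a left inverse. Hence left multiplication
  by \<open>A\<close> is an injective real-linear endomorphism of a finite-dimensional space, so it
  is surjective and yields a right inverse, which must be the same matrix.\<close>

lemma Sp2_right:
  assumes A: "A \<in> Sp2"
  shows "qmat_mul A (qmat_adj A) = qmat_one"
proof -
  have "linear (\<lambda>C. qmat_mul A C)"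
    using linear_qmat_mul_adj_right [of "qmat_adj A"] by (simp add: qmat_adj_adj)
  moreover have "inj (\<lambda>C. qmat_mul A C)"
    by (metis A Sp2_left injI qmat_mul_assoc qmat_mul_one(2))
  ultimately have "surj (\<lambda>C. qmat_mul A C)"
    using linear_injective_imp_surjective by blast
  then obtain C where C: "qmat_mul A C = qmat_one" by (metis surjD)
  then have "C = qmat_adj A"
    by (metis A Sp2_left qmat_mul_assoc qmat_mul_one)
  then show ?thesis using C by simp
qed

lemma bounded_bilinear_adj_mul: "bounded_bilinear (\<lambda>A C. qmat_mul (qmat_adj A) C)"
  by (simp add: bilinear_conv_bounded_bilinear [symmetric] bilinear_def
      linear_qmat_mul_adj_right linear_qmat_mul_adj_left)

text \<open>These rules recognise the functionals that read a form off an entry of the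
  Maurer--Cartan matrix as bounded linear.\<close>

lemmas component_intros =
  bounded_linear_compose [OF bounded_linear_fst] bounded_linear_compose [OF bounded_linear_snd]
  bounded_linear_compose [OF bounded_linear_Im] bounded_linear_compose [OF bounded_linear_cnj]
  bounded_linear_compose [OF bounded_linear_vec_nth] bounded_linear_vec_nth
  bounded_linear_compose [OF bounded_linear_mult_right]

lemma frechet_derivative_linear_comp:
  assumes "bounded_linear L" "smooth_on W f" "z \<in> W"
  shows "frechet_derivative (\<lambda>y. L (f y)) (at z) v = L (frechet_derivative f (at z) v)"
  using frechet_derivative_eqI [OF bounded_linear.has_derivative [OF assms(1)
      smooth_on_has_derivative [OF assms(2,3)]]] by simp

lemma smooth_on_mc:
  assumes "open W" "smooth_on W s"
  shows "smooth_on W (\<lambda>y. mc s y v)"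
  unfolding mc_def
  by (rule smooth_on_bilinear [OF bounded_bilinear_adj_mul assms smooth_on_D [OF assms(2)]])

lemma linear_mc:
  assumes "s differentiable (at z)"
  shows "linear (mc s z)"
  using linear_compose [OF linear_frechet_derivative [OF assms] linear_qmat_mul_adj_right [of "s z"]]
  by (simp add: mc_def [abs_def] comp_def)

context
  fixes W :: "complex set" and s :: "complex \<Rightarrow> quat^2^2" and z :: complex
  assumes W: "open W" "z \<in> W" and s: "smooth_on W s" and Sp: "\<And>y. y \<in> W \<Longrightarrow> s y \<in> Sp2"
begin

lemma mc_nth:
  "mc s z v $ 1 $ 1 = (\<i> * of_real (\<rho>1 s z v), cnj (\<omega>3 s z v))"
  "mc s z v $ 1 $ 2 = (- cnj (\<omega>1 s z v) / of_real (sqrt 2), \<omega>2 s z v / of_real (sqrt 2))"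
  "mc s z v $ 2 $ 1 = (\<omega>1 s z v / of_real (sqrt 2), \<omega>2 s z v / of_real (sqrt 2))"
  "mc s z v $ 2 $ 2 = (\<i> * of_real (\<rho>2 s z v), \<tau> s z v)"
  by (subst mc_matrix [OF W Sp smooth_on_differentiable [OF s W(2)]]; simp)+

lemma mc_skew: "qmat_adj (mc s z v) = - mc s z v"
  by (simp add: vec_eq_iff forall_2 qmat_adj_def mc_nth qcnj_def)

text \<open>This is \<open>d\<Omega> = - \<Omega> \<and> \<Omega>\<close> on the commuting constant
  fields \<open>v\<close> and \<open>w\<close>. In the derivative of \<open>s\<^sup>* ds\<close> the
  second derivatives of \<open>s\<close> cancel by symmetry, and the remaining products are
  evaluated with \<open>ds = s \<Omega>\<close> and
  \<open>\<Omega>\<^sup>* = - \<Omega>\<close>.\<close>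

lemma maurer_cartan:
  "frechet_derivative (\<lambda>y. mc s y w) (at z) v - frechet_derivative (\<lambda>y. mc s y v) (at z) w =
    qmat_mul (mc s z w) (mc s z v) - qmat_mul (mc s z v) (mc s z w)"
proof -
  let ?D = "\<lambda>v y. frechet_derivative s (at y) v"
  have D: "frechet_derivative (\<lambda>y. mc s y w) (at z) v =
    qmat_mul (qmat_adj (s z)) (frechet_derivative (?D w) (at z) v) +
    qmat_mul (qmat_adj (?D v z)) (?D w z)" for v w
    unfolding mc_def
    using frechet_derivative_eqI [OF bounded_bilinear.FDERIV [OF bounded_bilinear_adj_mul
        smooth_on_has_derivative [OF s W(2)] smooth_on_has_derivative [OF smooth_on_D [OF s] W(2)]]]
    by simp
  have sym: "frechet_derivative (?D w) (at z) v = frechet_derivative (?D v) (at z) w"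
    by (rule second_derivative_symmetric [OF W s])
  have sD: "?D v z = qmat_mul (s z) (mc s z v)" for v
    by (metis Sp2_right [OF Sp [OF W(2)]] mc_def qmat_mul_assoc qmat_mul_one(2))
  have *: "qmat_mul (qmat_adj (?D v z)) (?D w z) = - qmat_mul (mc s z v) (mc s z w)" for v w
  proof -
    have "qmat_adj (?D v z) = qmat_mul (qmat_adj (mc s z v)) (qmat_adj (s z))"
      unfolding sD by (rule qmat_adj_mul)
    then have "qmat_mul (qmat_adj (?D v z)) (?D w z) = qmat_mul (qmat_adj (mc s z v)) (mc s z w)"
      by (simp add: qmat_mul_assoc mc_def)
    then show ?thesis by (simp add: mc_skew qmat_adj_minus)
  qed
  show ?thesis by (simp add: D sym *)
qed

text \<open>A fixed linear functional commutes with differentiation, so every entry of the matrix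
  equation yields one structure equation.\<close>

lemma mc_component_derivative:
  assumes "bounded_linear L"
  shows "frechet_derivative (\<lambda>y. L (mc s y w)) (at z) v - frechet_derivative (\<lambda>y. L (mc s y v)) (at z) w =
    L (qmat_mul (mc s z w) (mc s z v) - qmat_mul (mc s z v) (mc s z w))"
  unfolding maurer_cartan [symmetric]
    frechet_derivative_linear_comp [OF assms smooth_on_mc [OF W(1) s] W(2)]
  using assms by (simp add: linear_diff bounded_linear.linear)

section \<open>Structure equations for lifts with \<open>\<omega>2 = 0\<close>\<close>

lemma structure_\<omega>1:
  assumes "\<And>v. \<omega>2 s z v = 0"
  shows "frechet_derivative (\<lambda>y. \<omega>1 s y w) (at z) v - frechet_derivative (\<lambda>y. \<omega>1 s y v) (at z) w =
    - \<i> * ((of_real (\<rho>2 s z v) - of_real (\<rho>1 s z v)) * \<omega>1 s z w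
          - (of_real (\<rho>2 s z w) - of_real (\<rho>1 s z w)) * \<omega>1 s z v)"
proof -
  have "bounded_linear (\<lambda>M::quat^2^2. complex_of_real (sqrt 2) * fst (M $ 2 $ 1))"
    by (intro component_intros)
  from mc_component_derivative [OF this, folded \<omega>1_def] show ?thesis
    by (simp add: qmat_mul_def UNIV_2 mc_nth qmul_def assms algebra_simps)
qed

text \<open>As \<open>\<omega>2\<close> vanishes on all of \<open>W\<close>, so does its derivative,
  and its structure equation turns into an algebraic relation between the other forms. This is the
  source of \<open>\<tau>\<close> being of type (1,0).\<close>

lemma structure_\<omega>2:
  assumes "\<And>y v. y \<in> W \<Longrightarrow> \<omega>2 s y v = 0"
  shows "\<tau> s z v * \<omega>1 s z w - \<tau> s z w * \<omega>1 s z v =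
    cnj (\<omega>1 s z w) * cnj (\<omega>3 s z v) - cnj (\<omega>1 s z v) * cnj (\<omega>3 s z w)"
proof -
  have b: "bounded_linear (\<lambda>M::quat^2^2. complex_of_real (sqrt 2) * snd (M $ 2 $ 1))"
    by (intro component_intros)
  have "frechet_derivative (\<lambda>y. \<omega>2 s y v) (at z) = (\<lambda>v. 0)" for v
    by (rule frechet_derivative_eqI, rule has_derivative_transform_within_open [OF _ W, of "\<lambda>y. 0"])
       (use assms in auto)
  with mc_component_derivative [OF b, folded \<omega>2_def] show ?thesis
    by (simp add: qmat_mul_def UNIV_2 mc_nth qmul_def assms W algebra_simps)
qed

lemma structure_\<omega>3:
  assumes "\<And>v. \<omega>2 s z v = 0"
  shows "frechet_derivative (\<lambda>y. \<omega>3 s y w) (at z) v - frechet_derivative (\<lambda>y. \<omega>3 s y v) (at z) w =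
    - 2 * \<i> * (of_real (\<rho>1 s z v) * \<omega>3 s z w - of_real (\<rho>1 s z w) * \<omega>3 s z v)"
proof -
  have "bounded_linear (\<lambda>M::quat^2^2. cnj (snd (M $ 1 $ 1)))"
    by (intro component_intros)
  from mc_component_derivative [OF this, folded \<omega>3_def] show ?thesis
    by (simp add: qmat_mul_def UNIV_2 mc_nth qmul_def assms algebra_simps)
qed

lemma structure_\<tau>:
  assumes "\<And>v. \<omega>2 s z v = 0"
  shows "frechet_derivative (\<lambda>y. \<tau> s y w) (at z) v - frechet_derivative (\<lambda>y. \<tau> s y v) (at z) w =
    2 * \<i> * (of_real (\<rho>2 s z v) * \<tau> s z w - of_real (\<rho>2 s z w) * \<tau> s z v)"
proof -
  have "bounded_linear (\<lambda>M::quat^2^2. snd (M $ 2 $ 2))"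
    by (intro component_intros)
  from mc_component_derivative [OF this, folded \<tau>_def] show ?thesis
    by (simp add: qmat_mul_def UNIV_2 mc_nth qmul_def assms algebra_simps)
qed

lemma structure_\<rho>1:
  assumes "\<And>v. \<omega>2 s z v = 0"
  shows "\<i> * of_real (frechet_derivative (\<lambda>y. \<rho>1 s y w) (at z) v - frechet_derivative (\<lambda>y. \<rho>1 s y v) (at z) w) =
    \<omega>3 s z v * cnj (\<omega>3 s z w) - \<omega>3 s z w * cnj (\<omega>3 s z v)
    - (\<omega>1 s z v * cnj (\<omega>1 s z w) - \<omega>1 s z w * cnj (\<omega>1 s z v)) / 2"
proof -
  have "bounded_linear (\<lambda>M::quat^2^2. Im (fst (M $ 1 $ 1)))"
    by (intro component_intros)
  from mc_component_derivative [OF this, folded \<rho>1_def, of w v] show ?thesis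
    by (simp add: qmat_mul_def UNIV_2 mc_nth qmul_def assms complex_eq_iff field_simps)
qed

lemma structure_\<rho>2:
  assumes "\<And>v. \<omega>2 s z v = 0"
  shows "\<i> * of_real (frechet_derivative (\<lambda>y. \<rho>2 s y w) (at z) v - frechet_derivative (\<lambda>y. \<rho>2 s y v) (at z) w) =
    (\<omega>1 s z v * cnj (\<omega>1 s z w) - \<omega>1 s z w * cnj (\<omega>1 s z v)) / 2
    - (\<tau> s z v * cnj (\<tau> s z w) - \<tau> s z w * cnj (\<tau> s z v))"
proof -
  have "bounded_linear (\<lambda>M::quat^2^2. Im (fst (M $ 2 $ 2)))"
    by (intro component_intros)
  from mc_component_derivative [OF this, folded \<rho>2_def, of w v] show ?thesis
    by (simp add: qmat_mul_def UNIV_2 mc_nth qmul_def assms complex_eq_iff field_simps)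
qed

end

section \<open>Lifts adapted to the curve\<close>

lemma has_derivative_vector3:
  fixes f1 f2 f3 :: "'a::real_normed_vector \<Rightarrow> 'b::{real_normed_vector}"
  assumes "(f1 has_derivative d1) F" "(f2 has_derivative d2) F" "(f3 has_derivative d3) F"
  shows "((\<lambda>x. vector [f1 x, f2 x, f3 x] :: 'b^3) has_derivative (\<lambda>h. vector [d1 h, d2 h, d3 h])) F"
proof -
  have v: "(vector [p, q, r] :: 'b^3) = axis 1 p + axis 2 q + axis 3 r" for p q r
    by (simp add: vec_eq_iff forall_3 axis_def)
  show ?thesis
    unfolding v by (intro has_derivative_add bounded_linear.has_derivative [OF bounded_linear_axis] assms)
qed

lemma vector3_scaled: "(c::complex) *s vector [p, q, r] = (vector [c * p, c * q, c * r] :: complex^3)"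
  by (simp add: vec_eq_iff forall_3)

lemma matrix3_vector: "vector [vector [a1, a2, a3], vector [b1, b2, b3], vector [c1, c2, c3]] *v (vector [x, y, z] :: complex^3) =
  (vector [a1 * x + a2 * y + a3 * z, b1 * x + b2 * y + b3 * z, c1 * x + c2 * y + c3 * z] :: complex^3)"
  by (simp add: vec_eq_iff forall_3 matrix_vector_mult_def sum_3)

lemma vector3_eqI:
  "p = p' \<Longrightarrow> q = q' \<Longrightarrow> r = r' \<Longrightarrow> (vector [p, q, r] :: complex^3) = vector [p', q', r']"
  by simp

text \<open>What a section of \<open>Q\<close> provides in a coordinate: \<open>a\<close> is the
  angle function read in that coordinate, \<open>J\<close> is the \<open>\<omega>1\<close> part of
  \<open>J\<close>-holomorphicity, and \<open>nz\<close> holds because the curve is nowhere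
  vertical. The whole computation thus takes place on an open subset of the complex plane.\<close>

locale Q_lift =
  fixes W :: "complex set" and s :: "complex \<Rightarrow> quat^2^2" and a :: "complex \<Rightarrow> real"
  assumes open_W: "open W" and smooth_s: "smooth_on W s" and Sp: "\<And>y. y \<in> W \<Longrightarrow> s y \<in> Sp2"
    and \<omega>2: "\<And>y v. y \<in> W \<Longrightarrow> \<omega>2 s y v = 0"
    and \<omega>3: "\<And>y v. y \<in> W \<Longrightarrow> \<omega>3 s y v = of_real (a y) * \<omega>1 s y v"
    and J: "\<And>y v. y \<in> W \<Longrightarrow> \<omega>1 s y (\<i> * v) = \<i> * \<omega>1 s y v"
    and nz: "\<And>y. y \<in> W \<Longrightarrow> \<omega>1 s y 1 \<noteq> 0"
begin

text \<open>The coefficient in \<open>\<omega>1 = h dz\<close>; see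
  \<open>\<omega>1_eq\<close>.\<close>

definition h :: "complex \<Rightarrow> complex" where "h y = \<omega>1 s y 1"
definition dh :: "complex \<Rightarrow> complex \<Rightarrow> complex" where "dh y = frechet_derivative h (at y)"
definition da :: "complex \<Rightarrow> complex \<Rightarrow> real" where "da y = frechet_derivative a (at y)"
text \<open>\<open>i \<sigma>\<close> is
  \<open>\<kappa>\<^sub>1\<^sub>1 - \<kappa>\<^sub>3\<^sub>3\<close>, the difference of the diagonal
  connection forms belonging to \<open>e\<^sub>1\<close> and \<open>e\<^sub>3\<close>.\<close>

definition \<sigma> :: "complex \<Rightarrow> complex \<Rightarrow> real" where "\<sigma> y v = \<rho>2 s y v - 3 * \<rho>1 s y v"
text \<open>Since \<open>TX\<close> is spanned by \<open>e\<^sub>1 + a e\<^sub>3\<close>, this is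
  the covariant derivative of the slope \<open>a\<close>: differentiating that vector leaves
  \<open>\<theta> e\<^sub>3\<close> modulo \<open>TX\<close> and \<open>e\<^sub>2\<close>.\<close>

definition \<theta> :: "complex \<Rightarrow> complex \<Rightarrow> complex"
  where "\<theta> y v = of_real (da y v) - \<i> * of_real (a y) * of_real (\<sigma> y v)"
abbreviation R :: "complex \<Rightarrow> complex" where "R y \<equiv> (of_real (a y))\<^sup>2 + 1"

lemma R_nz: "R y \<noteq> 0"
proof -
  have "R y = of_real ((a y)\<^sup>2 + 1)" by simp
  moreover have "(a y)\<^sup>2 + 1 \<noteq> 0" by (simp add: add_nonneg_eq_0_iff)
  ultimately show ?thesis by (metis of_real_eq_0_iff)
qed

lemma h_nz: "y \<in> W \<Longrightarrow> h y \<noteq> 0"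
  by (simp add: h_def nz)

lemma lin: "y \<in> W \<Longrightarrow> linear (mc s y)"
  by (rule linear_mc [OF smooth_on_differentiable [OF smooth_s]])

lemma \<omega>1_eq: assumes "y \<in> W" shows "\<omega>1 s y v = h y * v"
proof -
  have l: "linear (\<omega>1 s y)"
    using linear_add [OF lin [OF assms]] linear_scale [OF lin [OF assms]]
    by (intro linearI) (simp_all add: \<omega>1_def algebra_simps)
  have "\<omega>1 s y v = \<omega>1 s y (Re v *\<^sub>R 1 + Im v *\<^sub>R (\<i> * 1))"
    by (simp add: scaleR_conv_of_real mult.commute flip: complex_eq)
  also have "\<dots> = Re v *\<^sub>R \<omega>1 s y 1 + Im v *\<^sub>R \<omega>1 s y (\<i> * 1)"
    by (simp only: linear_add [OF l] linear_scale [OF l])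
  also have "\<dots> = h y * (of_real (Re v) + \<i> * of_real (Im v))"
    unfolding J [OF assms] by (simp add: h_def scaleR_conv_of_real algebra_simps)
  finally show ?thesis by (simp flip: complex_eq)
qed

lemma smooth_forms:
  "smooth_on W (\<lambda>y. \<omega>1 s y v)" "smooth_on W (\<lambda>y. \<omega>3 s y v)" "smooth_on W (\<lambda>y. \<tau> s y v)"
  "smooth_on W (\<lambda>y. \<rho>1 s y v)" "smooth_on W (\<lambda>y. \<rho>2 s y v)"
  unfolding \<omega>1_def \<omega>3_def \<tau>_def \<rho>1_def \<rho>2_def
  by (rule smooth_on_linear [OF _ open_W smooth_on_mc [OF open_W smooth_s]]; intro component_intros)+

lemma smooth_h: "smooth_on W h"
  using smooth_forms(1) [of 1] by (simp add: h_def [abs_def])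

text \<open>\<open>a\<close> is the quotient of the smooth functions \<open>\<omega>3 s y 1\<close>
  and \<open>h y\<close>; the real part brings this complex quotient back to a real
  function.\<close>

lemma smooth_a: "smooth_on W a"
proof -
  have "smooth_on W (\<lambda>y. Re (\<omega>3 s y 1 * inverse (h y)))"
    by (intro smooth_on_linear [OF bounded_linear_Re] smooth_on_mult smooth_on_inverse open_W
        smooth_forms smooth_h h_nz)
  then show ?thesis
    by (rule smooth_on_cong [OF open_W, rotated]) (use h_nz in \<open>simp add: \<omega>3 h_def [symmetric] mult.assoc\<close>)
qed

lemma smooth_da: "smooth_on W (\<lambda>y. da y v)"
  unfolding da_def by (rule smooth_on_D [OF smooth_a])

lemma smooth_\<sigma>: "smooth_on W (\<lambda>y. \<sigma> y v)"
proof -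
  have "smooth_on W (\<lambda>y. \<rho>2 s y v + (- 3) * \<rho>1 s y v)"
    by (intro smooth_on_add smooth_on_mult smooth_on_const open_W smooth_forms)
  then show ?thesis by (simp add: \<sigma>_def)
qed

lemma h_has_derivative: "y \<in> W \<Longrightarrow> (h has_derivative dh y) (at y)"
  unfolding dh_def by (rule smooth_on_has_derivative [OF smooth_h])

lemma a_has_derivative: "y \<in> W \<Longrightarrow> (a has_derivative da y) (at y)"
  unfolding da_def by (rule smooth_on_has_derivative [OF smooth_a])

lemma dphi_eq: "y \<in> W \<Longrightarrow> dphi s y \<xi> = vector [h y * \<xi>, 0, of_real (a y) * h y * \<xi>]"
  by (simp add: dphi_def \<omega>2 \<omega>3 \<omega>1_eq mult.assoc)

section \<open>The connection and the second fundamental form in the frame\<close>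

lemma nabla_dphi:
  assumes y: "y \<in> W"
  shows "nabla s (\<lambda>y. dphi s y \<xi>) y v =
    vector [\<xi> * (dh y v + \<i> * (of_real (\<rho>2 s y v) - of_real (\<rho>1 s y v)) * h y),
      \<xi> * (\<tau> s y v * h y),
      \<xi> * (of_real (da y v) * h y + of_real (a y) * dh y v + 2 * \<i> * of_real (\<rho>1 s y v) * of_real (a y) * h y)]"
proof -
  have "((\<lambda>y. vector [h y * \<xi>, 0, of_real (a y) * h y * \<xi>] :: complex^3) has_derivative
    (\<lambda>v. vector [dh y v * \<xi>, 0, (of_real (da y v) * h y + of_real (a y) * dh y v) * \<xi>])) (at y)"
    by (intro has_derivative_vector3)
       (auto intro!: derivative_eq_intros h_has_derivative a_has_derivative y simp: algebra_simps)
  then have "((\<lambda>y. dphi s y \<xi>) has_derivative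
    (\<lambda>v. vector [dh y v * \<xi>, 0, (of_real (da y v) * h y + of_real (a y) * dh y v) * \<xi>])) (at y)"
    by (rule has_derivative_transform_within_open [OF _ open_W y]) (simp add: dphi_eq)
  then have 1: "frechet_derivative (\<lambda>y. dphi s y \<xi>) (at y) v =
    vector [dh y v * \<xi>, 0, (of_real (da y v) * h y + of_real (a y) * dh y v) * \<xi>]"
    by (rule frechet_derivative_eqI [THEN fun_cong])
  show ?thesis
    unfolding nabla_def 1 dphi_eq [OF y] \<kappa>_def matrix3_vector
    by (simp add: vec_eq_iff forall_3 algebra_simps)
qed

lemma tang_part_eq:
  assumes y: "y \<in> W"
  shows "tang_part s y w = (w $ 1 + of_real (a y) * w $ 3) / (h y * R y)"
proof -
  have "tang_part s y w = ((w $ 1 + of_real (a y) * w $ 3) * cnj (h y)) / ((h y * R y) * cnj (h y))"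
    unfolding tang_part_def dphi_eq [OF y] herm_def
    by (simp add: sum_3 algebra_simps power2_eq_square)
  then show ?thesis using h_nz [OF y] by simp
qed

text \<open>The normal space is spanned by \<open>f\<^sub>3 = e\<^sub>2\<close> and by
  \<open>(-a, 0, 1)\<close>, which is \<open>- r f\<^sub>2\<close> for
  \<open>r = sqrt (a\<^sup>2 + 1)\<close>; \<open>m w\<close> is the coefficient of the latter
  vector.\<close>

lemma norm_part_eq:
  assumes y: "y \<in> W"
  defines "m w \<equiv> (w $ 3 - of_real (a y) * w $ 1) / R y"
  shows "norm_part s y w = vector [- of_real (a y) * m w, w $ 2, m w]"
proof -
  have "w1 - h y * ((w1 + of_real (a y) * w3) / (h y * R y)) = - of_real (a y) * ((w3 - of_real (a y) * w1) / R y)"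
    "w3 - of_real (a y) * h y * ((w1 + of_real (a y) * w3) / (h y * R y)) = (w3 - of_real (a y) * w1) / R y"
    for w1 w3
  proof -
    have "w1 - (w1 + A * w3) / r = - A * ((w3 - A * w1) / r)" "w3 - A * ((w1 + A * w3) / r) = (w3 - A * w1) / r"
      if "r = A * A + 1" "r \<noteq> 0" for A r
      using that(2) by (simp_all add: field_simps) (simp_all add: that(1) algebra_simps)
    from this [of "R y" "of_real (a y)"] show
      "w1 - h y * ((w1 + of_real (a y) * w3) / (h y * R y)) = - of_real (a y) * ((w3 - of_real (a y) * w1) / R y)"
      "w3 - of_real (a y) * h y * ((w1 + of_real (a y) * w3) / (h y * R y)) = (w3 - of_real (a y) * w1) / R y"
      using h_nz [OF y] R_nz [of y] by (simp_all add: power2_eq_square)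
  qed
  then show ?thesis
    unfolding norm_part_def tang_part_eq [OF y] dphi_eq [OF y]
    by (simp add: vec_eq_iff forall_3 m_def)
qed

text \<open>\<open>dphi s y \<xi>\<close> is \<open>h \<xi> (e\<^sub>1 + a e\<^sub>3)\<close>, so
  the derivative of \<open>h\<close> is tangential and drops out. Of the rest the projection keeps
  \<open>\<tau>\<close> along \<open>f\<^sub>3\<close> and the combination \<open>\<theta>\<close>
  along \<open>(-a, 0, 1)\<close>.\<close>

lemma II_eq:
  assumes y: "y \<in> W"
  shows "II s y w \<xi> = vector [- of_real (a y) * (\<xi> * (h y * \<theta> y w / R y)), \<xi> * (h y * \<tau> s y w),
     \<xi> * (h y * \<theta> y w / R y)]"
  unfolding II_def norm_part_eq [OF y] nabla_dphi [OF y]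
  by (rule vector3_eqI; simp add: \<theta>_def \<sigma>_def algebra_simps)

text \<open>The derivative of \<open>\<theta> y w\<close> at \<open>z\<close> in direction
  \<open>v\<close>: the argument of the form comes first, the direction last.\<close>

definition dtheta :: "complex \<Rightarrow> complex \<Rightarrow> complex \<Rightarrow> complex"
  where "dtheta w z v = of_real (frechet_derivative (\<lambda>y. da y w) (at z) v) - \<i> * (of_real (da z v) * of_real (\<sigma> z w)
    + of_real (a z) * of_real (frechet_derivative (\<lambda>y. \<sigma> y w) (at z) v))"

lemma \<theta>_has_derivative:
  assumes z: "z \<in> W"
  shows "((\<lambda>y. \<theta> y w) has_derivative dtheta w z) (at z)"
  unfolding \<theta>_def dtheta_def [abs_def]
  by (auto intro!: derivative_eq_intros a_has_derivative z smooth_on_has_derivative smooth_da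
      smooth_\<sigma> simp: algebra_simps)

text \<open>\<open>M\<close> and \<open>N\<close> are the coefficients of \<open>(-a, 0, 1)\<close>
  and \<open>f\<^sub>3\<close>. The derivative of \<open>h\<close> enters both through
  \<open>II\<close> and through \<open>\<nabla>\<^sup>T\<close> of the constant field
  \<open>\<xi>\<close>; the two contributions cancel, which is why \<open>dh\<close> is absent from
  \<open>M\<close> and \<open>N\<close>.\<close>

lemma nabla_Hom_II:
  assumes z: "z \<in> W"
  defines "M v w \<equiv> h z / R z * (dtheta w z v + (\<i> * ((of_real (a z))\<^sup>2 - 1) * of_real (\<sigma> z v)
        - 2 * of_real (a z) * of_real (da z v)) * \<theta> z w / R z + of_real (a z) * cnj (\<tau> s z v) * \<tau> s z w)"
    and "N v w \<equiv> h z * (frechet_derivative (\<lambda>y. \<tau> s y w) (at z) v - of_real (a z) * \<tau> s z v * \<theta> z w / R z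
        - (\<i> * (of_real (\<rho>1 s z v) + of_real (\<rho>2 s z v)) + (\<i> * (of_real (\<rho>2 s z v) - of_real (\<rho>1 s z v))
          + of_real (a z) * of_real (da z v) + 2 * \<i> * (of_real (a z))\<^sup>2 * of_real (\<rho>1 s z v)) / R z) * \<tau> s z w)"
  shows "nabla_Hom s (\<lambda>y. II s y w) z v \<xi> =
    vector [- of_real (a z) * (\<xi> * M v w), \<xi> * N v w, \<xi> * M v w]"
proof -
  define dt where "dt = frechet_derivative (\<lambda>y. \<tau> s y w) (at z)"
  \<comment> \<open>\<open>K\<close> is the coefficient of \<open>II\<close> along
    \<open>(-a, 0, 1)\<close> for \<open>\<xi> = 1\<close>, and \<open>dK\<close> its derivative by
    the quotient rule.\<close>
  define K where "K y = h y * \<theta> y w / R y" for y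
  define dK where "dK v = ((dh z v * \<theta> z w + h z * dtheta w z v) * R z
     - h z * \<theta> z w * (2 * of_real (a z) * of_real (da z v))) / (R z * R z)" for v
  have K: "(K has_derivative dK) (at z)"
  proof -
    have "((\<lambda>y. h y * \<theta> y w) has_derivative (\<lambda>v. h z * dtheta w z v + dh z v * \<theta> z w)) (at z)"
      by (rule has_derivative_mult [OF h_has_derivative [OF z] \<theta>_has_derivative [OF z]])
    moreover have "(R has_derivative (\<lambda>v. 2 * of_real (a z) * of_real (da z v))) (at z)"
      by (auto intro!: derivative_eq_intros a_has_derivative z)
    ultimately have "((\<lambda>y. h y * \<theta> y w / R y) has_derivative (\<lambda>v. ((h z * dtheta w z v + dh z v * \<theta> z w) * R z
      - h z * \<theta> z w * (2 * of_real (a z) * of_real (da z v))) / (R z * R z))) (at z)"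
      by (rule has_derivative_divide' [where g = R]) (rule R_nz)
    then show ?thesis
      by (simp add: K_def [abs_def] dK_def [abs_def] add.commute)
  qed
  have "((\<lambda>y. vector [- of_real (a y) * (\<xi> * K y), \<xi> * (h y * \<tau> s y w), \<xi> * K y] :: complex^3) has_derivative
    (\<lambda>v. vector [- (\<xi> * (of_real (da z v) * K z + of_real (a z) * dK v)), \<xi> * (dh z v * \<tau> s z w + h z * dt v),
      \<xi> * dK v])) (at z)"
  proof (intro has_derivative_vector3)
    have t: "((\<lambda>y. \<tau> s y w) has_derivative dt) (at z)"
      unfolding dt_def by (rule smooth_on_has_derivative [OF smooth_forms(3) z])
    show "((\<lambda>y. - of_real (a y) * (\<xi> * K y)) has_derivative
      (\<lambda>v. - (\<xi> * (of_real (da z v) * K z + of_real (a z) * dK v)))) (at z)"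
      by (auto intro!: derivative_eq_intros a_has_derivative K z simp: algebra_simps)
    show "((\<lambda>y. \<xi> * (h y * \<tau> s y w)) has_derivative (\<lambda>v. \<xi> * (dh z v * \<tau> s z w + h z * dt v))) (at z)"
      by (auto intro!: derivative_eq_intros h_has_derivative t z simp: algebra_simps)
    show "((\<lambda>y. \<xi> * K y) has_derivative (\<lambda>v. \<xi> * dK v)) (at z)"
      by (rule has_derivative_mult_right [OF K])
  qed
  then have "((\<lambda>y. II s y w \<xi>) has_derivative
    (\<lambda>v. vector [- (\<xi> * (of_real (da z v) * K z + of_real (a z) * dK v)), \<xi> * (dh z v * \<tau> s z w + h z * dt v),
      \<xi> * dK v])) (at z)"
    by (rule has_derivative_transform_within_open [OF _ open_W z]) (simp add: II_eq K_def)
  then have 1: "frechet_derivative (\<lambda>y. II s y w \<xi>) (at z) v =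
    vector [- (\<xi> * (of_real (da z v) * K z + of_real (a z) * dK v)), \<xi> * (dh z v * \<tau> s z w + h z * dt v),
      \<xi> * dK v]"
    by (rule frechet_derivative_eqI [THEN fun_cong])
  have II: "II s z w \<xi> = vector [- of_real (a z) * (\<xi> * K z), \<xi> * (h z * \<tau> s z w), \<xi> * K z]" for \<xi>
    using II_eq [OF z] by (simp add: K_def)
  define r1 r2 A B t t' H where "r1 = complex_of_real (\<rho>1 s z v)" "r2 = complex_of_real (\<rho>2 s z v)"
    "A = complex_of_real (a z)" "B = complex_of_real (da z v)" "t = \<tau> s z v" "t' = \<tau> s z w" "H = dh z v"
  note defs = this
  have nz: "h z \<noteq> 0" "R z \<noteq> 0" using h_nz [OF z] R_nz by auto
  have n: "nabla s (\<lambda>y. II s y w \<xi>) z v = vector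
     [\<xi> * (- B * K z - A * dK v - \<i> * (r2 - r1) * A * K z - cnj t * (h z * t')),
      \<xi> * (H * t' + h z * dt v - t * A * K z - \<i> * (r1 + r2) * (h z * t')),
      \<xi> * (dK v + 2 * \<i> * r1 * K z)]"
    unfolding nabla_def 1 II \<kappa>_def matrix3_vector defs
    by (simp add: vec_eq_iff forall_3 algebra_simps)
  \<comment> \<open>The connection form of \<open>\<nabla>\<^sup>T\<close> in the coordinate
    trivialisation of \<open>TX\<close>, evaluated on \<open>v\<close>.\<close>
  define c where "c = (H + \<i> * (r2 - r1) * h z + A * (B * h z + A * H + 2 * \<i> * r1 * A * h z)) / (h z * R z)"
  have T: "nabla_T s (\<lambda>y. \<xi>) z v = \<xi> * c"
    unfolding nabla_T_def tang_part_eq [OF z] nabla_dphi [OF z] c_def defs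
    by (simp add: algebra_simps)
  have RA: "R z = A * A + 1" by (simp add: defs power2_eq_square)
  have s: "complex_of_real (\<sigma> z v) = r2 - 3 * r1" by (simp add: \<sigma>_def defs)
  \<comment> \<open>With the inverses of \<open>R z\<close> and \<open>h z\<close> treated as
    variables subject to polynomial equations, the two coefficient identities below become
    polynomial and fall to \<open>algebra\<close>.\<close>
  define x y where "x = inverse (A * A + 1)" "y = inverse (h z)"
  note x_def = this
  have x: "x * (A * A + 1) = 1" and y: "y * h z = 1" using nz unfolding x_def RA by simp_all
  have Kx: "K z = h z * \<theta> z w * x"
    by (simp add: K_def divide_inverse x_def RA)
  have "(p * r - q) / (r * r) = p * inverse r - q * inverse r * inverse r" if "r \<noteq> 0" for p q r :: complex
    using that by (simp add: field_simps)
  from this [OF nz(2)] have dKx: "dK v = (H * \<theta> z w + h z * dtheta w z v) * x - h z * \<theta> z w * (2 * A * B) * x * x"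
    unfolding dK_def RA x_def by (simp add: defs)
  have cx: "c = (H + \<i> * (r2 - r1) * h z + A * (B * h z + A * H + 2 * \<i> * r1 * A * h z)) * y * x"
    unfolding c_def RA x_def by (simp add: divide_inverse)
  have M: "(dK v + 2 * \<i> * r1 * K z - A * (- B * K z - A * dK v - \<i> * (r2 - r1) * A * K z - cnj t * (h z * t'))) / R z
      - c * K z = M v w"
  proof -
    \<comment> \<open>Constants such as \<open>\<i>\<close> and \<open>cnj t\<close> and the values
      of the forms in \<open>w\<close> are replaced by free variables, so that a pure ideal
      membership problem remains.\<close>
    have "(dK + 2 * ii * r1 * K - A * (- B * K - A * dK - ii * (r2 - r1) * A * K - tb * (h * t'))) * x - c * K =
      h * x * (d\<theta> + (ii * (A * A - 1) * (r2 - 3 * r1) - 2 * A * B) * th * x + A * tb * t')"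
      if "x * (A * A + 1) = 1" "y * h = 1" "K = h * th * x" "dK = (H * th + h * d\<theta>) * x - h * th * (2 * A * B) * x * x"
        "c = (H + ii * (r2 - r1) * h + A * (B * h + A * H + 2 * ii * r1 * A * h)) * y * x"
      for dK K x y h ii d\<theta> th c tb :: complex
      using that by algebra
    note this [OF x y Kx dKx cx, of "cnj t"]
    moreover have "M v w = h z * x * (dtheta w z v + (\<i> * (A * A - 1) * (r2 - 3 * r1) - 2 * A * B) * \<theta> z w * x
        + A * cnj t * t')"
      by (simp add: M_def s divide_inverse defs [symmetric] x_def power2_eq_square)
    ultimately show ?thesis
      by (simp add: divide_inverse x_def RA)
  qed
  have N: "H * t' + h z * dt v - t * A * K z - \<i> * (r1 + r2) * (h z * t') - c * (h z * t') = N v w"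
  proof -
    have "H * t' + h * dt - t * A * K - ii * (r1 + r2) * (h * t') - c * (h * t') =
      h * (dt - A * t * th * x - (ii * (r1 + r2) + (ii * (r2 - r1) + A * B + 2 * ii * (A * A) * r1) * x) * t')"
      if "x * (A * A + 1) = 1" "y * h = 1" "K = h * th * x"
        "c = (H + ii * (r2 - r1) * h + A * (B * h + A * H + 2 * ii * r1 * A * h)) * y * x"
      for K x y h ii dt th c :: complex
      using that by algebra
    note this [OF x y Kx cx, of "dt v"]
    moreover have "N v w = h z * (dt v - A * t * \<theta> z w * x - (\<i> * (r1 + r2) + (\<i> * (r2 - r1) + A * B
        + 2 * \<i> * (A * A) * r1) * x) * t')"
      by (simp add: N_def divide_inverse defs [symmetric] x_def power2_eq_square dt_def)
    ultimately show ?thesis by simp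
  qed
  show ?thesis
    unfolding nabla_Hom_def nabla_N_def norm_part_eq [OF z] n T II M [symmetric] N [symmetric]
    by (simp add: vec_eq_iff forall_3 defs algebra_simps diff_divide_distrib add_divide_distrib)
qed

section \<open>Forms of type (1,0) and the covariant exterior derivative of the second fundamental
  form\<close>

context
  fixes z assumes z: "z \<in> W"
begin

lemma \<omega>1_derivative: "frechet_derivative (\<lambda>y. \<omega>1 s y w) (at z) v = dh z v * w"
proof -
  have "((\<lambda>y. h y * w) has_derivative (\<lambda>v. dh z v * w)) (at z)"
    by (rule has_derivative_mult_left [OF h_has_derivative [OF z]])
  then have "((\<lambda>y. \<omega>1 s y w) has_derivative (\<lambda>v. dh z v * w)) (at z)"
    by (rule has_derivative_transform_within_open [OF _ open_W z]) (simp add: \<omega>1_eq)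
  then show ?thesis by (rule frechet_derivative_eqI [THEN fun_cong])
qed

lemma \<omega>3_derivative:
  "frechet_derivative (\<lambda>y. \<omega>3 s y w) (at z) v = (of_real (da z v) * h z + of_real (a z) * dh z v) * w"
proof -
  have "((\<lambda>y. of_real (a y) * h y * w) has_derivative
      (\<lambda>v. (of_real (da z v) * h z + of_real (a z) * dh z v) * w)) (at z)"
    by (auto intro!: derivative_eq_intros h_has_derivative a_has_derivative z simp: algebra_simps)
  then have "((\<lambda>y. \<omega>3 s y w) has_derivative
      (\<lambda>v. (of_real (da z v) * h z + of_real (a z) * dh z v) * w)) (at z)"
    by (rule has_derivative_transform_within_open [OF _ open_W z]) (simp add: \<omega>1_eq \<omega>3)
  then show ?thesis by (rule frechet_derivative_eqI [THEN fun_cong])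
qed

text \<open>With \<open>\<omega>3 = a \<omega>1\<close>, the right-hand side of
  \<open>structure_\<omega>2\<close> is a multiple of
  \<open>cnj \<omega>1 \<and> cnj \<omega>1 = 0\<close>. The conclusion is type (1,0) in the form
  \<open>\<tau> \<and> dz = 0\<close>.\<close>

lemma \<tau>_linear: "\<tau> s z v * w = \<tau> s z w * v"
proof -
  have "\<tau> s z v * (h z * w) - \<tau> s z w * (h z * v) = 0"
    using structure_\<omega>2 [OF open_W z smooth_s Sp \<omega>2, of v w] by (simp add: \<omega>3 \<omega>1_eq z)
  then have "h z * (\<tau> s z v * w - \<tau> s z w * v) = 0" by (simp add: algebra_simps)
  then show ?thesis using h_nz [OF z] by simp
qed

text \<open>Differentiating \<open>\<omega>3 = a \<omega>1\<close> and inserting the structure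
  equations of both forms gives \<open>\<theta> \<and> \<omega>1 = 0\<close>.\<close>

lemma \<theta>_linear: "\<theta> z v * w = \<theta> z w * v"
proof -
  note 1 = structure_\<omega>1 [OF open_W z smooth_s Sp \<omega>2 [OF z], of w v, unfolded \<omega>1_derivative \<omega>1_eq [OF z]]
  note 3 = structure_\<omega>3 [OF open_W z smooth_s Sp \<omega>2 [OF z], of w v, unfolded \<omega>3_derivative \<omega>3 [OF z] \<omega>1_eq [OF z]]
  have "h z * (\<theta> z v * w - \<theta> z w * v) = 0"
    using 1 3 unfolding \<theta>_def \<sigma>_def of_real_diff of_real_mult of_real_numeral by algebra
  then show ?thesis using h_nz [OF z] by simp
qed

text \<open>The two-form \<open>\<omega>1 \<and> cnj \<omega>1\<close>, of which
  \<open>vol_H\<close> is the multiple by \<open>\<i> / 2\<close>.\<close>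

definition Z :: "complex \<Rightarrow> complex \<Rightarrow> complex"
  where "Z v w = \<omega>1 s z v * cnj (\<omega>1 s z w) - \<omega>1 s z w * cnj (\<omega>1 s z v)"

text \<open>The coefficient 2 is \<open>1/2 + 3/2\<close>, from the \<open>\<omega>1\<close> terms
  of \<open>\<rho>2\<close> and of \<open>- 3 \<rho>1\<close>; the \<open>- 3 a\<^sup>2\<close>
  comes from \<open>\<omega>3 \<and> cnj \<omega>3 = a\<^sup>2 \<omega>1 \<and> cnj
  \<omega>1\<close>.\<close>

lemma d\<sigma>:
  "\<i> * of_real (frechet_derivative (\<lambda>y. \<sigma> y w) (at z) v - frechet_derivative (\<lambda>y. \<sigma> y v) (at z) w) =
    (2 - 3 * (of_real (a z))\<^sup>2) * Z v w - (\<tau> s z v * cnj (\<tau> s z w) - \<tau> s z w * cnj (\<tau> s z v))"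
proof -
  have D: "frechet_derivative (\<lambda>y. \<sigma> y w) (at z) v =
    frechet_derivative (\<lambda>y. \<rho>2 s y w) (at z) v - 3 * frechet_derivative (\<lambda>y. \<rho>1 s y w) (at z) v" for v w
    unfolding \<sigma>_def
    by (rule frechet_derivative_eqI [THEN fun_cong])
       (intro has_derivative_diff has_derivative_mult_right smooth_on_has_derivative [OF _ z] smooth_forms)
  have eq: "\<i> * of_real (frechet_derivative (\<lambda>y. \<sigma> y w) (at z) v - frechet_derivative (\<lambda>y. \<sigma> y v) (at z) w) =
    \<i> * of_real (frechet_derivative (\<lambda>y. \<rho>2 s y w) (at z) v - frechet_derivative (\<lambda>y. \<rho>2 s y v) (at z) w)
    - 3 * (\<i> * of_real (frechet_derivative (\<lambda>y. \<rho>1 s y w) (at z) v - frechet_derivative (\<lambda>y. \<rho>1 s y v) (at z) w))"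
    by (simp add: D algebra_simps)
  note 1 = structure_\<rho>1 [OF open_W z smooth_s Sp \<omega>2 [OF z], where v = v and w = w]
  note 2 = structure_\<rho>2 [OF open_W z smooth_s Sp \<omega>2 [OF z], where v = v and w = w]
  show ?thesis
    unfolding eq
    by (subst 1, assumption, subst 2, assumption)
       (simp add: Z_def \<omega>3 z field_simps power2_eq_square)
qed

text \<open>Since \<open>d(da) = 0\<close>, the exterior derivative of
  \<open>\<theta> = da - i a \<sigma>\<close> is
  \<open>- i da \<and> \<sigma> - i a d\<sigma>\<close>.\<close>

lemma dtheta_skew:
  "dtheta w z v - dtheta v z w = - \<i> * (of_real (da z v) * of_real (\<sigma> z w) - of_real (da z w) * of_real (\<sigma> z v))
    - of_real (a z) * ((2 - 3 * (of_real (a z))\<^sup>2) * Z v w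
      - (\<tau> s z v * cnj (\<tau> s z w) - \<tau> s z w * cnj (\<tau> s z v)))"
proof -
  have sym: "frechet_derivative (\<lambda>y. da y w) (at z) v = frechet_derivative (\<lambda>y. da y v) (at z) w"
    unfolding da_def by (rule second_derivative_symmetric [OF open_W z smooth_a])
  show ?thesis
    unfolding d\<sigma> [symmetric] dtheta_def sym by (simp add: algebra_simps)
qed

lemma d_nabla_II:
  "d_nabla s (II s) z v w \<xi> = (2 * \<i> * of_real (a z) / of_real ((a z)\<^sup>2 + 1) * of_real (- 2 + 3 * (a z)\<^sup>2) *
             vol_H s z v w * u_coframe (a z) 1 (dphi s z \<xi>)) *s f_frame (a z) 2"
proof -
  let ?a = "complex_of_real (a z)"
  let ?m = "\<lambda>v w. dtheta w z v + (\<i> * (?a\<^sup>2 - 1) * of_real (\<sigma> z v)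
        - 2 * ?a * of_real (da z v)) * \<theta> z w / R z + ?a * cnj (\<tau> s z v) * \<tau> s z w"
  let ?n = "\<lambda>v w. frechet_derivative (\<lambda>y. \<tau> s y w) (at z) v - ?a * \<tau> s z v * \<theta> z w / R z
        - (\<i> * (of_real (\<rho>1 s z v) + of_real (\<rho>2 s z v)) + (\<i> * (of_real (\<rho>2 s z v) - of_real (\<rho>1 s z v))
          + ?a * of_real (da z v) + 2 * \<i> * ?a\<^sup>2 * of_real (\<rho>1 s z v)) / R z) * \<tau> s z w"
  define x where "x = inverse (R z)"
  have x: "x * (?a * ?a + 1) = 1" using R_nz [of z] by (simp add: x_def power2_eq_square)
  \<comment> \<open>After inserting \<open>\<theta> = da - i a \<sigma>\<close>, the skew part of
    the term divided by \<open>R\<close> is \<open>i da \<and> \<sigma>\<close>, which cancels its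
    negative in \<open>dtheta_skew\<close>; the products of \<open>\<tau>\<close> and
    \<open>cnj \<tau>\<close> cancel as well.\<close>
  have m: "?m v w - ?m w v = ?a * (3 * ?a\<^sup>2 - 2) * Z v w"
  proof -
    have "(d1 + (ii * (p * p - 1) * sv - 2 * p * bv) * (bw - ii * p * sw) * x + p * ctv * tw)
      - (d2 + (ii * (p * p - 1) * sw - 2 * p * bw) * (bv - ii * p * sv) * x + p * ctw * tv) = p * (3 * (p * p) - 2) * \<zeta>"
      if "x * (p * p + 1) = 1"
        "d1 - d2 = - ii * (bv * sw - bw * sv) - p * ((2 - 3 * (p * p)) * \<zeta> - (tv * ctw - tw * ctv))"
      for d1 d2 ii p sv sw bv bw x tv tw ctv ctw \<zeta> :: complex
      using that by algebra
    from this [OF x dtheta_skew [of w v, unfolded power2_eq_square]] show ?thesis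
      by (simp only: \<theta>_def divide_inverse x_def power2_eq_square)
  qed
  \<comment> \<open>As \<open>\<theta> \<and> \<tau> = 0\<close>, \<open>da\<close> may be replaced
    by \<open>i a \<sigma>\<close> in front of \<open>\<tau>\<close>. The bracket then sums to
    \<open>2 i \<rho>2\<close>, which cancels against
    \<open>d\<tau> = 2 i \<rho>2 \<and> \<tau>\<close>.\<close>
  have n: "?n v w - ?n w v = 0"
  proof -
    have "(d1 - p * tv * \<theta>w * x - (ii * (r1v + r2v) + (ii * (r2v - r1v) + p * bv + 2 * ii * (p * p) * r1v) * x) * tw)
      - (d2 - p * tw * \<theta>v * x - (ii * (r1w + r2w) + (ii * (r2w - r1w) + p * bw + 2 * ii * (p * p) * r1w) * x) * tv) = 0"
      if "x * (p * p + 1) = 1" "d1 - d2 = 2 * ii * (r2v * tw - r2w * tv)" "tv = t * v" "tw = t * w"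
        "\<theta>v = q * v" "\<theta>w = q * w" "\<theta>v = bv - ii * p * (r2v - 3 * r1v)" "\<theta>w = bw - ii * p * (r2w - 3 * r1w)"
      for d1 d2 ii p r1v r1w r2v r2w bv bw x tv tw t q v w \<theta>v \<theta>w :: complex
      using that by algebra
    note * = this [OF x structure_\<tau> [OF open_W z smooth_s Sp \<omega>2 [OF z]]]
    have "\<tau> s z v = \<tau> s z 1 * v" "\<theta> z v = \<theta> z 1 * v" for v
      using \<tau>_linear [of v 1] \<theta>_linear [of v 1] by simp_all
    moreover have "\<theta> z v = of_real (da z v) - \<i> * ?a * (of_real (\<rho>2 s z v) - 3 * of_real (\<rho>1 s z v))" for v
      by (simp add: \<theta>_def \<sigma>_def)
    ultimately show ?thesis
      unfolding divide_inverse x_def [symmetric] power2_eq_square [of ?a] unfolding x_def power2_eq_square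
      by (intro * [unfolded x_def power2_eq_square])
  qed
  have "d_nabla s (II s) z v w \<xi> = vector [- ?a * (\<xi> * (h z / R z * (?m v w - ?m w v))), \<xi> * (h z * (?n v w - ?n w v)),
     \<xi> * (h z / R z * (?m v w - ?m w v))]"
    unfolding d_nabla_def nabla_Hom_II [OF z]
    by (simp add: vec_eq_iff forall_3 right_diff_distrib)
  also have "\<dots> = vector [- ?a * (\<xi> * (h z / R z * (?a * (3 * ?a\<^sup>2 - 2) * Z v w))), 0,
     \<xi> * (h z / R z * (?a * (3 * ?a\<^sup>2 - 2) * Z v w))]"
    unfolding m n by simp
  also have "\<dots> = (2 * \<i> * of_real (a z) / of_real ((a z)\<^sup>2 + 1) * of_real (- 2 + 3 * (a z)\<^sup>2) *
             vol_H s z v w * u_coframe (a z) 1 (dphi s z \<xi>)) *s f_frame (a z) 2"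
  proof -
    \<comment> \<open>\<open>r\<close> is the length of \<open>e\<^sub>1 + a e\<^sub>3\<close>. On
      \<open>TX\<close> one has \<open>u\<^sub>1 = r \<omega>1\<close>, and
      \<open>(-a, 0, 1) = - r f\<^sub>2\<close>, so both sides carry one factor
      \<open>r\<close>.\<close>
    define r where "r = complex_of_real (sqrt ((a z)\<^sup>2 + 1))"
    have r2: "r * r = R z"
      by (simp add: r_def flip: of_real_mult)
    then have r: "r \<noteq> 0" "R z \<noteq> 0" using R_nz by auto
    have rR: "R z / r = r" using r r2 by (simp add: field_simps)
    have u: "u_coframe (a z) 1 (dphi s z \<xi>) = h z * \<xi> * r"
    proof -
      have "u_coframe (a z) 1 (dphi s z \<xi>) = h z * \<xi> * (R z / r)"
        unfolding u_coframe_def dphi_eq [OF z] r_def [symmetric]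
        by (simp add: algebra_simps power2_eq_square add_divide_distrib)
      then show ?thesis by (simp only: rR)
    qed
    have vol: "vol_H s z v w = \<i> / 2 * Z v w" by (simp add: vol_H_def Z_def)
    have f: "f_frame (a z) 2 = vector [?a / r, 0, - 1 / r]"
      by (simp add: f_frame_def r_def)
    have Rr: "of_real ((a z)\<^sup>2 + 1) = R z" by simp
    have c: "2 * \<i> * of_real (a z) / of_real ((a z)\<^sup>2 + 1) * of_real (- 2 + 3 * (a z)\<^sup>2) *
             vol_H s z v w * u_coframe (a z) 1 (dphi s z \<xi>) = - (\<xi> * (h z / R z * (?a * (3 * ?a\<^sup>2 - 2) * Z v w))) * r"
    proof -
      have "2 * \<i> * A * q * m * (\<i> * \<zeta>) * (k * \<xi> * r) = - (\<xi> * (k * q * (A * m * (2 * \<zeta>)))) * r" for A q m \<zeta> k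
        using i_squared by algebra
      note * = this
      have m: "complex_of_real (- 2 + 3 * (a z)\<^sup>2) = 3 * ?a\<^sup>2 - 2" by simp
      have half: "\<i> / 2 * Z v w = \<i> * (Z v w / 2)" "Z v w = 2 * (Z v w / 2)" by simp_all
      show ?thesis
        unfolding u vol Rr m half(1) by (subst (2) half(2), unfold divide_inverse [of _ "R z"], rule *)
    qed
    show ?thesis unfolding c f vector3_scaled using r by (intro vector3_eqI) simp_all
  qed
  finally show ?thesis .
qed

end

text \<open>For this value of \<open>a\<close> the curvature term \<open>2 - 3 a\<^sup>2\<close> of
  \<open>d\<sigma>\<close> vanishes, so that \<open>\<sigma> = 0\<close> leaves
  \<open>\<tau> \<and> cnj \<tau> = 0\<close>.\<close>

lemma \<tau>_eq_0_if_angle_constant: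
  assumes c: "\<And>y. y \<in> W \<Longrightarrow> (a y)\<^sup>2 = 2 / 3" and z: "z \<in> W"
  shows "\<tau> s z v = 0"
proof -
  have a: "a y \<noteq> 0" if "y \<in> W" for y using c [OF that] by auto
  \<comment> \<open>Differentiating \<open>a\<^sup>2\<close> avoids a choice of sign for
    \<open>a\<close>.\<close>
  have da: "da y v = 0" if y: "y \<in> W" for y v
  proof -
    have "((\<lambda>y. (a y)\<^sup>2) has_derivative (\<lambda>v. 2 * a y * da y v)) (at y)"
      by (auto intro!: derivative_eq_intros a_has_derivative y)
    moreover have "((\<lambda>y. (a y)\<^sup>2) has_derivative (\<lambda>v. 0)) (at y)"
      by (rule has_derivative_transform_within_open [OF has_derivative_const [of "2 / 3"] open_W y])
         (simp add: c)
    ultimately have "2 * a y * da y v = 0" by (rule has_derivative_unique [THEN fun_cong])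
    then show ?thesis using a [OF y] by simp
  qed
  have \<sigma>0: "\<sigma> y v = 0" if y: "y \<in> W" for y v
  proof -
    have th: "\<theta> y v = - \<i> * of_real (a y * \<sigma> y v)" for v by (simp add: \<theta>_def da [OF y])
    \<comment> \<open>\<open>\<theta>\<close> takes imaginary values, so complex linearity
      \<open>\<theta>(\<i>) = \<i> \<theta>(1)\<close> equates an imaginary with a real
      number.\<close>
    have "a y * \<sigma> y 1 = 0"
      using \<theta>_linear [OF y, of \<i> 1] unfolding th complex_eq_iff by simp
    then have "\<theta> y 1 = 0" by (simp only: th) simp
    then have "\<theta> y v = 0" using \<theta>_linear [OF y, of v 1] by simp
    then show ?thesis using a [OF y] by (simp add: th)
  qed
  have "frechet_derivative (\<lambda>y. \<sigma> y w) (at z) = (\<lambda>v. 0)" for w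
    by (rule frechet_derivative_eqI,
        rule has_derivative_transform_within_open [OF has_derivative_const [of 0] open_W z]) (simp add: \<sigma>0)
  moreover have "(complex_of_real (a z))\<^sup>2 = 2 / 3"
    using c [OF z] by (metis of_real_divide of_real_numeral of_real_power)
  moreover have "\<tau> s z \<i> = \<i> * \<tau> s z 1" using \<tau>_linear [OF z, of \<i> 1] by simp
  \<comment> \<open>On the pair \<open>(\<i>, 1)\<close> the form
    \<open>\<tau> \<and> cnj \<tau>\<close> has the value
    \<open>2 \<i> |\<tau>(1)|\<^sup>2\<close>.\<close>
  ultimately have "\<tau> s z 1 * cnj (\<tau> s z 1) = 0"
    using d\<sigma> [OF z, of \<i> 1] by (simp add: algebra_simps)
  then show ?thesis using \<tau>_linear [OF z, of v 1] by simp
qed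

end

section \<open>Existence of lifts\<close>

lemma smooth_on_norm:
  fixes f :: "'a::real_normed_vector \<Rightarrow> 'b::real_inner"
  assumes "open S" "\<And>x. x \<in> S \<Longrightarrow> f x \<noteq> 0" "smooth_on S f"
  shows "smooth_on S (\<lambda>x. norm (f x))"
  unfolding norm_eq_sqrt_inner
  by (intro smooth_on_sqrt smooth_on_bilinear [OF bounded_bilinear_inner] assms) (simp add: assms)

lemma smooth_on_sgn:
  fixes f :: "'a::real_normed_vector \<Rightarrow> 'b::real_inner"
  assumes "open S" "\<And>x. x \<in> S \<Longrightarrow> f x \<noteq> 0" "smooth_on S f"
  shows "smooth_on S (\<lambda>x. sgn (f x))"
  unfolding sgn_div_norm
  by (intro smooth_on_bilinear [OF bounded_bilinear_scaleR] smooth_on_inverse smooth_on_norm assms)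
     (simp_all add: assms)

section \<open>Quaternion arithmetic and the group \<open>Sp(2)\<close>\<close>

lemma bounded_bilinear_qmul: "bounded_bilinear qmul"
  by (simp add: bilinear_conv_bounded_bilinear [symmetric] bilinear_def linear_iff qmul_linear)

lemma bounded_linear_qcnj: "bounded_linear qcnj"
  by (simp add: linear_conv_bounded_linear [symmetric] linear_iff qmul_linear)

lemma qmul_zero: "qmul 0 p = 0" "qmul p 0 = 0" "qcnj 0 = 0"
  by (simp_all add: qmul_def qcnj_def prod_eq_iff)

lemma qmul_one: "qmul (1, 0) p = p" "qmul p (1, 0) = p"
  by (simp_all add: qmul_def prod_eq_iff)

lemma qmul_minus: "qmul (- p) q = - qmul p q" "qmul p (- q) = - qmul p q"
  by (simp_all add: qmul_def prod_eq_iff)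

lemma qmul_of_real: "qmul (complex_of_real r, 0) p = r *\<^sub>R p" "qmul p (complex_of_real r, 0) = r *\<^sub>R p"
  by (simp_all add: qmul_def prod_eq_iff scaleR_conv_of_real mult.commute)

lemma qmul_qcnj: "qmul (qcnj p) p = (of_real ((norm p)\<^sup>2), 0)" "qmul p (qcnj p) = (of_real ((norm p)\<^sup>2), 0)"
proof -
  have "(norm p)\<^sup>2 = (cmod (fst p))\<^sup>2 + (cmod (snd p))\<^sup>2"
    by (simp add: norm_prod_def)
  then have "complex_of_real ((norm p)\<^sup>2) = fst p * cnj (fst p) + snd p * cnj (snd p)"
    by (simp only: of_real_add complex_norm_square)
  then show "qmul (qcnj p) p = (of_real ((norm p)\<^sup>2), 0)" "qmul p (qcnj p) = (of_real ((norm p)\<^sup>2), 0)"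
    by (simp_all add: qmul_def qcnj_def algebra_simps)
qed

text \<open>Reals are central in the quaternions, so the inner factor \<open>|p|\<^sup>2\<close> of
  the conjugate of \<open>p q\<close> times \<open>p q\<close> can be pulled out.\<close>

lemma norm_qmul: "norm (qmul p q) = norm p * norm q"
proof -
  have "qmul (qcnj (qmul p q)) (qmul p q) = qmul (qcnj q) (qmul (qmul (qcnj p) p) q)"
    by (simp add: qcnj_qmul qmul_assoc)
  then have "(complex_of_real ((norm (qmul p q))\<^sup>2), 0) = (of_real ((norm p * norm q)\<^sup>2), 0 :: complex)"
    by (simp only: qmul_qcnj qmul_of_real qmul_linear) (simp add: scaleR_conv_of_real power_mult_distrib)
  then have "(norm (qmul p q))\<^sup>2 = (norm p * norm q)\<^sup>2"
    by (simp only: prod.inject of_real_eq_iff)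
  then show ?thesis by simp
qed

lemma norm_qcnj: "norm (qcnj p) = norm p"
  by (simp add: qcnj_def norm_prod_def)

text \<open>Three equations suffice because the entry (2,1) of \<open>A\<^sup>* A\<close> is the
  conjugate of the entry (1,2).\<close>

lemma Sp2_columns:
  "A \<in> Sp2 \<longleftrightarrow> qmul (qcnj (A $ 1 $ 1)) (A $ 1 $ 1) + qmul (qcnj (A $ 2 $ 1)) (A $ 2 $ 1) = (1, 0) \<and>
     qmul (qcnj (A $ 1 $ 1)) (A $ 1 $ 2) + qmul (qcnj (A $ 2 $ 1)) (A $ 2 $ 2) = 0 \<and>
     qmul (qcnj (A $ 1 $ 2)) (A $ 1 $ 2) + qmul (qcnj (A $ 2 $ 2)) (A $ 2 $ 2) = (1, 0)" (is "_ \<longleftrightarrow> ?c11 \<and> ?c12 \<and> ?c22")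
proof -
  have "A \<in> Sp2 \<longleftrightarrow> ?c11 \<and> ?c12 \<and> ?c22 \<and>
    qmul (qcnj (A $ 1 $ 2)) (A $ 1 $ 1) + qmul (qcnj (A $ 2 $ 2)) (A $ 2 $ 1) = 0" (is "_ \<longleftrightarrow> _ \<and> _ \<and> _ \<and> ?c21")
    by (auto simp: Sp2_def vec_eq_iff forall_2 qmat_mul_def qmat_adj_def qmat_one_def UNIV_2)
  moreover have "?c21" if "?c12"
  proof -
    have "qmul (qcnj (A $ 1 $ 2)) (A $ 1 $ 1) + qmul (qcnj (A $ 2 $ 2)) (A $ 2 $ 1) =
      qcnj (qmul (qcnj (A $ 1 $ 1)) (A $ 1 $ 2) + qmul (qcnj (A $ 2 $ 1)) (A $ 2 $ 2))"
      by (simp add: qmul_linear qcnj_qmul qcnj_qcnj)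
    then show ?thesis using that by (simp add: qmul_zero)
  qed
  ultimately show ?thesis by blast
qed

text \<open>Read off the diagonal of \<open>A A\<^sup>* = 1\<close>, the product in the other
  order.\<close>

lemma Sp2_row_norm:
  assumes "A \<in> Sp2"
  shows "(norm (A $ i $ 1))\<^sup>2 + (norm (A $ i $ 2))\<^sup>2 = 1"
proof -
  have "qmat_mul A (qmat_adj A) $ i $ i = (1, 0)"
    using Sp2_right [OF assms] by (simp add: qmat_one_def)
  then have "complex_of_real ((norm (A $ i $ 1))\<^sup>2 + (norm (A $ i $ 2))\<^sup>2) = 1"
    by (simp add: qmat_mul_def qmat_adj_def UNIV_2 qmul_qcnj)
  then show ?thesis by (metis of_real_eq_1_iff)
qed

lemma Sp2_mul_adj:
  assumes "A \<in> Sp2" "B \<in> Sp2"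
  shows "qmat_mul (qmat_adj A) B \<in> Sp2"
proof -
  have "qmat_mul (qmat_adj (qmat_mul (qmat_adj A) B)) (qmat_mul (qmat_adj A) B) =
    qmat_mul (qmat_adj B) (qmat_mul (qmat_mul A (qmat_adj A)) B)"
    by (simp add: qmat_adj_mul qmat_adj_adj qmat_mul_assoc)
  then show ?thesis using assms by (simp only: Sp2_right Sp2_left qmat_mul_one) (simp add: Sp2_def)
qed

lemma cline_scale: "k \<noteq> 0 \<Longrightarrow> cline (k *s v) = cline v"
  unfolding cline_def
proof (intro set_eqI iffI; elim rangeE)
  fix w c assume "w = c *s (k *s v)"
  then show "w \<in> range (\<lambda>c. c *s v)" by (auto intro: range_eqI [of _ _ "c * k"])
next
  fix w c assume "k \<noteq> 0" "w = c *s v"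
  then show "w \<in> range (\<lambda>c. c *s (k *s v))" by (auto intro: range_eqI [of _ _ "c / k"])
qed

lemma cline_eqD:
  assumes "cline v = cline w"
  obtains k where "v = k *s w"
proof -
  have "v \<in> cline v" unfolding cline_def by (rule range_eqI [of _ _ 1]) simp
  then show ?thesis using assms that by (auto simp: cline_def)
qed

lemma forall_4: "(\<forall>i::4. P i) \<longleftrightarrow> P 1 \<and> P 2 \<and> P 3 \<and> P 4"
  by (metis exhaust_4)

lemma vector_4: "(vector [p, q, r, t] :: 'a::zero ^ 4) $ 1 = p" "(vector [p, q, r, t] :: 'a ^ 4) $ 2 = q"
  "(vector [p, q, r, t] :: 'a ^ 4) $ 3 = r" "(vector [p, q, r, t] :: 'a ^ 4) $ 4 = t"
  by (simp_all add: vector_def)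

lemma Sp2_proj_eq:
  "Sp2_proj g = cline (vector [fst (g $ 1 $ 1), snd (g $ 1 $ 1), fst (g $ 2 $ 1), snd (g $ 2 $ 1)])"
  by (simp add: Sp2_proj_def H2_to_C4_def qmat_vec_def UNIV_2 qmul_zero qmul_one)

text \<open>Representatives of a common line differ by a complex factor, which acts on quaternionic
  columns by multiplication from the right.\<close>

lemma Sp2_proj_eqD:
  assumes "Sp2_proj g = Sp2_proj g'"
  obtains k where "\<And>i. g $ i $ 1 = qmul (g' $ i $ 1) (k, 0)"
proof -
  obtain k where k: "vector [fst (g $ 1 $ 1), snd (g $ 1 $ 1), fst (g $ 2 $ 1), snd (g $ 2 $ 1)] =
    k *s (vector [fst (g' $ 1 $ 1), snd (g' $ 1 $ 1), fst (g' $ 2 $ 1), snd (g' $ 2 $ 1)] :: complex^4)"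
    using assms cline_eqD unfolding Sp2_proj_eq by blast
  have "\<forall>i. g $ i $ 1 = qmul (g' $ i $ 1) (k, 0)"
    using k by (simp add: vec_eq_iff forall_4 forall_2 vector_4 qmul_def prod_eq_iff mult.commute)
  then show ?thesis using that by blast
qed

section \<open>Smooth lifts of maps into \<open>CP\<^sup>3\<close>\<close>

definition qmat :: "quat \<Rightarrow> quat \<Rightarrow> quat \<Rightarrow> quat \<Rightarrow> quat^2^2"
  where "qmat p q r t = vector [vector [p, q], vector [r, t]]"

lemma qmat_nth: "qmat p q r t $ 1 $ 1 = p" "qmat p q r t $ 1 $ 2 = q"
   "qmat p q r t $ 2 $ 1 = r" "qmat p q r t $ 2 $ 2 = t"
  by (simp_all add: qmat_def)

lemma smooth_on_qmat:
  assumes "open S" "smooth_on S p" "smooth_on S q" "smooth_on S r" "smooth_on S t"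
  shows "smooth_on S (\<lambda>x. qmat (p x) (q x) (r x) (t x))"
proof -
  have "qmat (p x) (q x) (r x) (t x) = (\<chi> i k. if i = 1 then if k = 1 then p x else q x else if k = 1 then r x else t x)" for x
    by (simp add: vec_eq_iff forall_2 qmat_nth)
  moreover have "smooth_on S (\<lambda>x. if i = 1 then if k = 1 then p x else q x else if k = 1 then r x else t x)" for i k :: 2
    using assms by (cases "i = 1"; cases "k = 1") simp_all
  ultimately show ?thesis
    by (simp add: smooth_on_vec assms(1))
qed

lemma complete_unit_vector:
  fixes p1 p2 :: "complex \<Rightarrow> quat"
  assumes S: "open S" "smooth_on S p1" "smooth_on S p2" and nz: "\<And>x. x \<in> S \<Longrightarrow> p1 x \<noteq> 0"
    and unit: "\<And>x. x \<in> S \<Longrightarrow> (norm (p1 x))\<^sup>2 + (norm (p2 x))\<^sup>2 = 1"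
  obtains q1 q2 where "smooth_on S q1" "smooth_on S q2"
    "\<And>x. x \<in> S \<Longrightarrow> qmul (qcnj (p1 x)) (q1 x) + qmul (qcnj (p2 x)) (q2 x) = 0"
    "\<And>x. x \<in> S \<Longrightarrow> qmul (qcnj (q1 x)) (q1 x) + qmul (qcnj (q2 x)) (q2 x) = (1, 0)"
proof
  \<comment> \<open>Orthogonality asks for \<open>qcnj p1 q1 = - qcnj p2 q2\<close>. Choosing
    \<open>q2\<close> as the real number \<open>|p1|\<close> forces
    \<open>q1 = - (p1 / |p1|) qcnj p2\<close>, which is smooth where \<open>p1\<close> is nonzero
    and has norm \<open>|p2|\<close>, as normalisation requires.\<close>
  let ?q1 = "\<lambda>x. qmul (- sgn (p1 x)) (qcnj (p2 x))" and ?q2 = "\<lambda>x. (complex_of_real (norm (p1 x)), 0::complex)"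
  show "smooth_on S ?q1" "smooth_on S ?q2"
    by (intro smooth_on_bilinear [OF bounded_bilinear_qmul] smooth_on_minus smooth_on_sgn
        smooth_on_linear [OF bounded_linear_qcnj] smooth_on_Pair smooth_on_of_real smooth_on_norm
        smooth_on_const S nz; assumption)+
  fix x assume x: "x \<in> S"
  have "qmul (qcnj (p1 x)) (sgn (p1 x)) = (of_real (norm (p1 x)), 0)"
    using nz [OF x] by (simp add: sgn_div_norm qmul_linear qmul_qcnj power2_eq_square scaleR_conv_of_real)
  then have "qmul (qcnj (p1 x)) (?q1 x) = - (norm (p1 x) *\<^sub>R qcnj (p2 x))"
    by (simp add: qmul_minus qmul_of_real flip: qmul_assoc)
  then show "qmul (qcnj (p1 x)) (?q1 x) + qmul (qcnj (p2 x)) (?q2 x) = 0"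
    by (simp add: qmul_of_real)
  have "norm (?q1 x) = norm (p2 x)" using nz [OF x] by (simp add: norm_qmul norm_qcnj norm_sgn)
  moreover have "norm (?q2 x) = norm (p1 x)" by (simp add: norm_prod_def)
  ultimately have "qmul (qcnj (?q1 x)) (?q1 x) + qmul (qcnj (?q2 x)) (?q2 x) = (of_real ((norm (p2 x))\<^sup>2 + (norm (p1 x))\<^sup>2), 0)"
    unfolding qmul_qcnj by simp
  then show "qmul (qcnj (?q1 x)) (?q1 x) + qmul (qcnj (?q2 x)) (?q2 x) = (1, 0)"
    using unit [OF x] by (metis add.commute of_real_1)
qed

text \<open>Normalising \<open>F\<close> gives the first column of \<open>s\<close>, and
  \<open>complete_unit_vector\<close> adds a second one near \<open>x\<close>. It divides by the
  norm of one entry, and at least one of the two entries is nonzero at \<open>x\<close>.\<close>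

lemma local_lift:
  fixes F :: "complex \<Rightarrow> complex^4"
  assumes S: "open S" "x \<in> S" "smooth_on S F" and nz: "\<And>y. y \<in> S \<Longrightarrow> F y \<noteq> 0"
  obtains W s where "open W" "x \<in> W" "W \<subseteq> S" "smooth_on W s"
    "\<And>y. y \<in> W \<Longrightarrow> s y \<in> Sp2" "\<And>y. y \<in> W \<Longrightarrow> Sp2_proj (s y) = cline (F y)"
proof -
  \<comment> \<open>The inverse of the identification \<open>H2_to_C4\<close>, with the two
    quaternions as a pair.\<close>
  define P where "P y = ((F y $ 1, F y $ 2), (F y $ 3, F y $ 4))" for y
  have P0: "P y \<noteq> 0" if "y \<in> S" for y
    using nz [OF that] by (auto simp: P_def vec_eq_iff forall_4 prod_eq_iff)
  have "smooth_on S P"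
    unfolding P_def by (intro smooth_on_Pair smooth_on_nth S)
  then have sP: "smooth_on S (\<lambda>y. sgn (P y))" using S(1) P0 smooth_on_sgn by blast
  define p1 p2 where "p1 y = fst (sgn (P y))" "p2 y = snd (sgn (P y))" for y
  note p_def = this
  have p: "smooth_on S p1" "smooth_on S p2"
    unfolding p_def [abs_def] by (intro smooth_on_fst smooth_on_snd S sP)+
  have unit: "(norm (p1 y))\<^sup>2 + (norm (p2 y))\<^sup>2 = 1" if "y \<in> S" for y
  proof -
    have "norm (sgn (P y)) = 1" using P0 [OF that] by (simp add: norm_sgn)
    then show ?thesis by (simp add: norm_prod_def p_def)
  qed
  have proj: "Sp2_proj g = cline (F y)" if "y \<in> S" "g $ 1 $ 1 = p1 y" "g $ 2 $ 1 = p2 y" for g y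
  proof -
    have "vector [fst (g $ 1 $ 1), snd (g $ 1 $ 1), fst (g $ 2 $ 1), snd (g $ 2 $ 1)] =
      of_real (inverse (norm (P y))) *s F y"
      using that(2,3) by (simp add: vec_eq_iff forall_4 vector_4 p_def sgn_div_norm P_def scaleR_conv_of_real)
    then show ?thesis
      unfolding Sp2_proj_eq by (simp add: cline_scale P0 that(1))
  qed
  have open_nz: "open {y \<in> S. f y \<noteq> 0}" if "smooth_on S f" for f :: "complex \<Rightarrow> quat"
    using continuous_open_preimage [OF smooth_on_continuous [OF that] S(1), of "- {0}"]
    by (simp add: vimage_def Int_def open_Compl)
  have c1: "qmul (qcnj (p1 y)) (p1 y) + qmul (qcnj (p2 y)) (p2 y) = (1, 0)" if "y \<in> S" for y
    using arg_cong [OF unit [OF that], of complex_of_real] by (simp add: qmul_qcnj)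
  show ?thesis
  proof (cases "p1 x = 0")
    case False
    define W where "W = {y \<in> S. p1 y \<noteq> 0}"
    have W: "open W" "W \<subseteq> S" "x \<in> W" using open_nz p False S by (auto simp: W_def)
    obtain q1 q2 where q: "smooth_on W q1" "smooth_on W q2"
      "\<And>x. x \<in> W \<Longrightarrow> qmul (qcnj (p1 x)) (q1 x) + qmul (qcnj (p2 x)) (q2 x) = 0"
      "\<And>x. x \<in> W \<Longrightarrow> qmul (qcnj (q1 x)) (q1 x) + qmul (qcnj (q2 x)) (q2 x) = (1, 0)"
      by (rule complete_unit_vector [OF W(1) smooth_on_subset [OF p(1) W(2)] smooth_on_subset [OF p(2) W(2)]])
         (use unit W_def in auto)
    show ?thesis
    proof (rule that [of W "\<lambda>y. qmat (p1 y) (q1 y) (p2 y) (q2 y)"])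
      show "smooth_on W (\<lambda>y. qmat (p1 y) (q1 y) (p2 y) (q2 y))"
        by (intro smooth_on_qmat W q smooth_on_subset [OF p(1) W(2)] smooth_on_subset [OF p(2) W(2)])
    qed (use W q c1 proj in \<open>auto simp: Sp2_columns qmat_nth\<close>)
  next
    \<comment> \<open>The same construction with the two rows interchanged.\<close>
    case True
    then have "p2 x \<noteq> 0" using unit [OF S(2)] by auto
    define W where "W = {y \<in> S. p2 y \<noteq> 0}"
    have W: "open W" "W \<subseteq> S" "x \<in> W" using open_nz p \<open>p2 x \<noteq> 0\<close> S by (auto simp: W_def)
    obtain q2 q1 where q: "smooth_on W q2" "smooth_on W q1"
      "\<And>x. x \<in> W \<Longrightarrow> qmul (qcnj (p2 x)) (q2 x) + qmul (qcnj (p1 x)) (q1 x) = 0"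
      "\<And>x. x \<in> W \<Longrightarrow> qmul (qcnj (q2 x)) (q2 x) + qmul (qcnj (q1 x)) (q1 x) = (1, 0)"
      by (rule complete_unit_vector [OF W(1) smooth_on_subset [OF p(2) W(2)] smooth_on_subset [OF p(1) W(2)]])
         (use unit W_def in \<open>auto simp: add.commute\<close>)
    show ?thesis
    proof (rule that [of W "\<lambda>y. qmat (p1 y) (q1 y) (p2 y) (q2 y)"])
      show "smooth_on W (\<lambda>y. qmat (p1 y) (q1 y) (p2 y) (q2 y))"
        by (intro smooth_on_qmat W q smooth_on_subset [OF p(1) W(2)] smooth_on_subset [OF p(2) W(2)])
    qed (use W q c1 proj in \<open>auto simp: Sp2_columns qmat_nth add.commute\<close>)
  qed
qed

section \<open>Local sections and the action of the stabiliser\<close>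

lemma riemann_surface_chart:
  assumes "riemann_surface A" "(U, c) \<in> A"
  shows "open U" "open (c ` U)" "homeomorphism U (c ` U) c (inv_into U c)" "inj_on c U"
proof -
  show 1: "open U" "open (c ` U)" "homeomorphism U (c ` U) c (inv_into U c)"
    using assms by (auto simp: riemann_surface_def)
  show "inj_on c U"
    by (rule inj_on_inverseI [of _ "inv_into U c"]) (rule homeomorphism_apply1 [OF 1(3)])
qed

lemma ex_local_section:
  assumes A: "riemann_surface A" and \<phi>: "smooth_into_CP3 A \<phi>"
  obtains U c W s where "local_section A \<phi> U c W s" "x \<in> U" "c x \<in> W"
proof -
  obtain U c where U: "(U, c) \<in> A" "x \<in> U"
  proof -
    have "x \<in> (\<Union>(U, c)\<in>A. U)" using A by (simp add: riemann_surface_def)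
    then show ?thesis using that by auto
  qed
  obtain S F where S: "open S" "c x \<in> S" "S \<subseteq> c ` U" "smooth_on S F"
    and F: "\<And>z. z \<in> S \<Longrightarrow> F z \<noteq> 0 \<and> \<phi> (inv_into U c z) = cline (F z)"
    using bspec [OF conjunct2 [OF \<phi> [unfolded smooth_into_CP3_def]] U(1)] U(2) by auto
  obtain W s where W: "open W" "c x \<in> W" "W \<subseteq> S" "smooth_on W s"
    and s: "\<And>y. y \<in> W \<Longrightarrow> s y \<in> Sp2" "\<And>y. y \<in> W \<Longrightarrow> Sp2_proj (s y) = cline (F y)"
    using local_lift [OF S(1,2,4)] F by metis
  have "Sp2_proj (s y) = \<phi> (inv_into U c y)" if "y \<in> W" for y
    using s(2) [OF that] F W(3) that by auto
  moreover have "W \<subseteq> c ` U" using W(3) S(3) by blast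
  ultimately have "local_section A \<phi> U c W s"
    using U(1) W s(1) by (simp add: local_section_def)
  then show ?thesis using that U(2) W(2) by blast
qed

text \<open>Only the first column of \<open>s\<close> is differentiated here, so changing the second
  column affects these entries without any derivative of the change.\<close>

lemma mc_first_column:
  assumes "s differentiable (at z)"
  shows "mc s z v $ k $ 1 = qmul (qcnj (s z $ 1 $ k)) (frechet_derivative (\<lambda>y. s y $ 1 $ 1) (at z) v) +
    qmul (qcnj (s z $ 2 $ k)) (frechet_derivative (\<lambda>y. s y $ 2 $ 1) (at z) v)"
proof -
  have D: "(s has_derivative frechet_derivative s (at z)) (at z)"
    using assms by (simp add: frechet_derivative_works)
  have "frechet_derivative (\<lambda>y. s y $ i $ 1) (at z) v = frechet_derivative s (at z) v $ i $ 1" for i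
    by (intro frechet_derivative_eqI [THEN fun_cong] bounded_linear.has_derivative [OF bounded_linear_vec_nth] D)
  then show ?thesis
    by (simp add: mc_def qmat_mul_def qmat_adj_def UNIV_2)
qed

text \<open>This is the right action of the stabiliser element \<open>diag(1, q)\<close>. It rotates
  \<open>\<omega>1 + j \<omega>2\<close> and fixes \<open>\<omega>3\<close>, which is the freedom
  used to adapt a lift.\<close>

lemma gauge_section:
  assumes s: "local_section A \<phi> U c W s" and q: "smooth_on W q" "\<forall>z\<in>W. norm (q z) = 1"
  defines "s' \<equiv> \<lambda>z. qmat (s z $ 1 $ 1) (qmul (s z $ 1 $ 2) (q z)) (s z $ 2 $ 1) (qmul (s z $ 2 $ 2) (q z))"
  shows "local_section A \<phi> U c W s'"
    and "\<And>z v. z \<in> W \<Longrightarrow> mc s' z v $ 1 $ 1 = mc s z v $ 1 $ 1"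
    and "\<And>z v. z \<in> W \<Longrightarrow> mc s' z v $ 2 $ 1 = qmul (qcnj (q z)) (mc s z v $ 2 $ 1)"
proof -
  have W: "open W" and ss: "smooth_on W s" using s by (auto simp: local_section_def)
  have ss': "smooth_on W s'"
    unfolding s'_def
    by (intro smooth_on_qmat W smooth_on_bilinear [OF bounded_bilinear_qmul] smooth_on_nth ss q)
  have "s' z \<in> Sp2" if z: "z \<in> W" for z
  proof -
    have sz: "s z \<in> Sp2" using s z by (simp add: local_section_def)
    have "qmul (qcnj (q z)) (qmul (qmul (qcnj (s z $ 1 $ 2)) (s z $ 1 $ 2) + qmul (qcnj (s z $ 2 $ 2)) (s z $ 2 $ 2)) (q z)) = (1, 0)"
      using sz bspec [OF q(2) z] by (simp add: Sp2_columns qmul_one qmul_qcnj)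
    moreover have "qmul (qmul (qcnj (s z $ 1 $ 1)) (s z $ 1 $ 2) + qmul (qcnj (s z $ 2 $ 1)) (s z $ 2 $ 2)) (q z) = 0"
      using sz by (simp add: Sp2_columns qmul_zero)
    ultimately show ?thesis
      using sz by (simp add: Sp2_columns s'_def qmat_nth qcnj_qmul qmul_assoc qmul_linear)
  qed
  moreover have "Sp2_proj (s' z) = Sp2_proj (s z)" for z by (simp add: Sp2_proj_eq s'_def qmat_nth)
  ultimately show "local_section A \<phi> U c W s'"
    using s ss' by (simp add: local_section_def)
  fix z v assume z: "z \<in> W"
  note d = mc_first_column [OF smooth_on_differentiable [OF ss z]] mc_first_column [OF smooth_on_differentiable [OF ss' z]]
  show "mc s' z v $ 1 $ 1 = mc s z v $ 1 $ 1"
    unfolding d by (simp add: s'_def qmat_nth)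
  show "mc s' z v $ 2 $ 1 = qmul (qcnj (q z)) (mc s z v $ 2 $ 1)"
    unfolding d by (simp add: s'_def qmat_nth qcnj_qmul qmul_assoc qmul_linear)
qed

section \<open>Independence of the angle function from all choices\<close>

lemma norm_H_dphi: "norm_H (dphi s z \<xi>) = sqrt 2 * norm (mc s z \<xi> $ 2 $ 1)"
  and norm_V_dphi: "norm_V (dphi s z \<xi>) = cmod (snd (mc s z \<xi> $ 1 $ 1))"
proof -
  have "norm_H (dphi s z \<xi>) = sqrt ((sqrt 2)\<^sup>2 * ((cmod (fst (mc s z \<xi> $ 2 $ 1)))\<^sup>2 + (cmod (snd (mc s z \<xi> $ 2 $ 1)))\<^sup>2))"
    by (simp add: norm_H_def dphi_def \<omega>1_def \<omega>2_def norm_mult power_mult_distrib)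
  then show "norm_H (dphi s z \<xi>) = sqrt 2 * norm (mc s z \<xi> $ 2 $ 1)"
    by (simp only: real_sqrt_mult norm_prod_def) simp
  show "norm_V (dphi s z \<xi>) = cmod (snd (mc s z \<xi> $ 1 $ 1))"
    by (simp add: norm_V_def dphi_def \<omega>3_def)
qed

text \<open>Two lifts of the same map differ by a function with values in the stabiliser
  \<open>S\<^sup>1 \<times> S\<^sup>3\<close>.\<close>

lemma norms_independent_of_lift:
  assumes W: "open W" "z \<in> W" and Sp: "\<And>y. y \<in> W \<Longrightarrow> s y \<in> Sp2 \<and> s' y \<in> Sp2"
    and proj: "\<And>y. y \<in> W \<Longrightarrow> Sp2_proj (s' y) = Sp2_proj (s y)"
    and d: "s differentiable (at z)" "s' differentiable (at z)"
  shows "norm_H (dphi s' z \<xi>) = norm_H (dphi s z \<xi>)" "norm_V (dphi s' z \<xi>) = norm_V (dphi s z \<xi>)"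
proof -
  \<comment> \<open>The circle part of the transition function \<open>s\<^sup>-\<^sup>1 s'\<close>;
    this formula in \<open>s\<close> and \<open>s'\<close> makes it visibly differentiable.\<close>
  define l where "l y = qmat_mul (qmat_adj (s y)) (s' y) $ 1 $ 1" for y
  have l: "s' y $ i $ 1 = qmul (s y $ i $ 1) (l y) \<and> snd (l y) = 0" if y: "y \<in> W" for y i
  proof -
    obtain k where k: "\<And>i. s' y $ i $ 1 = qmul (s y $ i $ 1) (k, 0)"
      using Sp2_proj_eqD proj [OF y] by blast
    have "l y = qmul (qmul (qcnj (s y $ 1 $ 1)) (s y $ 1 $ 1) + qmul (qcnj (s y $ 2 $ 1)) (s y $ 2 $ 1)) (k, 0)"
      by (simp add: l_def qmat_mul_def qmat_adj_def UNIV_2 k qmul_linear qmul_assoc)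
    then have "l y = (k, 0)" using Sp [OF y] by (simp add: Sp2_columns qmul_one)
    then show ?thesis using k by simp
  qed
  have Dl: "(l has_derivative frechet_derivative l (at z)) (at z)"
  proof -
    have "((\<lambda>y. qmat_mul (qmat_adj (s y)) (s' y) $ 1 $ 1) has_derivative
      (\<lambda>v. (qmat_mul (qmat_adj (s z)) (frechet_derivative s' (at z) v) +
        qmat_mul (qmat_adj (frechet_derivative s (at z) v)) (s' z)) $ 1 $ 1)) (at z)"
      using d by (intro bounded_linear.has_derivative [OF bounded_linear_vec_nth]
          bounded_bilinear.FDERIV [OF bounded_bilinear_adj_mul]) (simp_all add: frechet_derivative_works)
    then show ?thesis unfolding l_def [abs_def] frechet_derivative_works [symmetric] differentiable_def by blast
  qed
  define \<mu> where "\<mu> = l z"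
  define e where "e = frechet_derivative l (at z) \<xi>"
  \<comment> \<open>\<open>l\<close> is complex valued near \<open>z\<close>, so its derivative has
    no \<open>j\<close>-component.\<close>
  have e: "snd e = 0"
  proof -
    have "((\<lambda>y. snd (l y)) has_derivative (\<lambda>v. snd (frechet_derivative l (at z) v))) (at z)"
      by (rule bounded_linear.has_derivative [OF bounded_linear_snd Dl])
    moreover have "((\<lambda>y. snd (l y)) has_derivative (\<lambda>v. 0)) (at z)"
      by (rule has_derivative_transform_within_open [OF has_derivative_const [of 0] W]) (simp add: l)
    ultimately show ?thesis unfolding e_def by (rule has_derivative_unique [THEN fun_cong])
  qed
  have lz: "s' z $ i $ 1 = qmul (s z $ i $ 1) \<mu>" "snd \<mu> = 0" for i using l [OF W(2)] by (simp_all add: \<mu>_def)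
  have Dcol: "frechet_derivative (\<lambda>y. s' y $ i $ 1) (at z) \<xi> =
    qmul (s z $ i $ 1) e + qmul (frechet_derivative (\<lambda>y. s y $ i $ 1) (at z) \<xi>) \<mu>" for i
  proof -
    have "((\<lambda>y. s y $ i $ 1) has_derivative frechet_derivative (\<lambda>y. s y $ i $ 1) (at z)) (at z)"
      using bounded_linear.has_derivative [OF bounded_linear_vec_nth, OF bounded_linear.has_derivative
        [OF bounded_linear_vec_nth]] d(1) unfolding frechet_derivative_works
      by (metis differentiable_def frechet_derivative_works)
    then have "((\<lambda>y. qmul (s y $ i $ 1) (l y)) has_derivative
      (\<lambda>v. qmul (s z $ i $ 1) (frechet_derivative l (at z) v) +
        qmul (frechet_derivative (\<lambda>y. s y $ i $ 1) (at z) v) (l z))) (at z)"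
      by (rule bounded_bilinear.FDERIV [OF bounded_bilinear_qmul _ Dl])
    then have "((\<lambda>y. s' y $ i $ 1) has_derivative
      (\<lambda>v. qmul (s z $ i $ 1) (frechet_derivative l (at z) v) +
        qmul (frechet_derivative (\<lambda>y. s y $ i $ 1) (at z) v) (l z))) (at z)"
      by (rule has_derivative_transform_within_open [OF _ W]) (simp add: l)
    then show ?thesis unfolding e_def \<mu>_def by (rule frechet_derivative_eqI [THEN fun_cong])
  qed
  have sz: "s z \<in> Sp2" "s' z \<in> Sp2" using Sp [OF W(2)] by auto
  have unit: "norm \<mu> = 1"
  proof -
    have "qmul (qcnj \<mu>) (qmul (qmul (qcnj (s z $ 1 $ 1)) (s z $ 1 $ 1) + qmul (qcnj (s z $ 2 $ 1)) (s z $ 2 $ 1)) \<mu>) =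
      qmul (qcnj (s' z $ 1 $ 1)) (s' z $ 1 $ 1) + qmul (qcnj (s' z $ 2 $ 1)) (s' z $ 2 $ 1)"
      by (simp add: lz qcnj_qmul qmul_assoc qmul_linear)
    then have "complex_of_real ((norm \<mu>)\<^sup>2) = 1"
      using sz by (simp add: Sp2_columns qmul_one qmul_qcnj)
    then have "(norm \<mu>)\<^sup>2 = 1" by (metis of_real_eq_1_iff)
    then show ?thesis by (metis abs_norm_cancel real_sqrt_abs real_sqrt_one)
  qed
  have mc': "mc s' z \<xi> $ k $ 1 =
    qmul (qmat_mul (qmat_adj (s' z)) (s z) $ k $ 1) e + qmul (qmat_mul (qmat_adj (s' z)) (frechet_derivative s (at z) \<xi>) $ k $ 1) \<mu>" for k
  proof -
    have "frechet_derivative (\<lambda>y. s y $ i $ 1) (at z) \<xi> = frechet_derivative s (at z) \<xi> $ i $ 1" for i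
      by (intro frechet_derivative_eqI [THEN fun_cong] bounded_linear.has_derivative [OF bounded_linear_vec_nth])
         (use d(1) in \<open>simp add: frechet_derivative_works\<close>)
    then show ?thesis
      unfolding mc_first_column [OF d(2)] Dcol
      by (simp add: qmat_mul_def qmat_adj_def UNIV_2 qmul_linear qmul_assoc)
  qed
  have Ds: "frechet_derivative s (at z) \<xi> = qmat_mul (s z) (mc s z \<xi>)"
    by (metis Sp2_right [OF sz(1)] mc_def qmat_mul_assoc qmat_mul_one(2))
  \<comment> \<open>The inverse of the transition matrix. Its first column turns out to be
    \<open>(qcnj \<mu>, 0)\<close>, and the row norms then force it to be diagonal with unit
    entries.\<close>
  define E where "E = qmat_mul (qmat_adj (s' z)) (s z)"
  have "mc s' z \<xi> $ k $ 1 = qmul (E $ k $ 1) e + qmul (qmat_mul E (mc s z \<xi>) $ k $ 1) \<mu>" for k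
    unfolding mc' E_def Ds qmat_mul_assoc ..
  then have mc'': "mc s' z \<xi> $ k $ 1 = qmul (E $ k $ 1) e +
      qmul (qmul (E $ k $ 1) (mc s z \<xi> $ 1 $ 1) + qmul (E $ k $ 2) (mc s z \<xi> $ 2 $ 1)) \<mu>" for k
    by (simp add: qmat_mul_def UNIV_2)
  have E: "E \<in> Sp2" unfolding E_def by (intro Sp2_mul_adj sz)
  have El: "qmul (E $ k $ 1) \<mu> = (if k = 1 then (1, 0) else 0)" for k
  proof -
    have "qmul (E $ k $ 1) \<mu> = qmat_mul (qmat_adj (s' z)) (s' z) $ k $ 1"
      by (simp add: E_def qmat_mul_def UNIV_2 qmul_linear qmul_assoc lz)
    then show ?thesis using Sp2_left [OF sz(2)] by (simp add: qmat_one_def)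
  qed
  have ll: "qmul \<mu> (qcnj \<mu>) = (1, 0)" using unit by (simp add: qmul_qcnj)
  have "E $ k $ 1 = qmul (qmul (E $ k $ 1) \<mu>) (qcnj \<mu>)" for k by (simp add: qmul_assoc ll qmul_one)
  from this [of 1] this [of 2] have E1: "E $ 1 $ 1 = qcnj \<mu>" "E $ 2 $ 1 = 0"
    by (simp_all add: El qmul_one qmul_zero)
  have "(norm (E $ 1 $ 2))\<^sup>2 = 0" "(norm (E $ 2 $ 2))\<^sup>2 = 1"
    using Sp2_row_norm [OF E, of 1] Sp2_row_norm [OF E, of 2] unit by (simp_all add: E1 norm_qcnj)
  then have E2: "E $ 1 $ 2 = 0" "norm (E $ 2 $ 2) = 1"
    by (simp, metis abs_norm_cancel real_sqrt_abs real_sqrt_one)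
  show "norm_H (dphi s' z \<xi>) = norm_H (dphi s z \<xi>)"
    unfolding norm_H_dphi mc'' by (simp add: E1 E2 qmul_zero norm_qmul unit)
  have "cmod (fst \<mu>) = 1" using unit lz(2) by (simp add: norm_prod_def)
  \<comment> \<open>The inhomogeneous term \<open>qcnj \<mu> e\<close> is complex, hence invisible
    in the \<open>j\<close>-component that carries \<open>\<omega>3\<close>.\<close>
  then show "norm_V (dphi s' z \<xi>) = norm_V (dphi s z \<xi>)"
    unfolding norm_V_dphi mc'' using lz(2) e
    by (simp add: E1 E2 qmul_zero) (simp add: qmul_def qcnj_def norm_mult)
qed

lemma local_section_chart:
  assumes A: "riemann_surface A" and s: "local_section A \<phi> U c W s" and z: "z \<in> W"
  shows "inv_into U c z \<in> U" "c (inv_into U c z) = z"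
  using s z by (auto simp: local_section_def intro: inv_into_into f_inv_into_f)

lemma local_section_differentiable:
  assumes "local_section A \<phi> U c W s" "z \<in> W"
  shows "s differentiable (at z)"
  using assms smooth_on_differentiable unfolding local_section_def by blast

lemma dphi_eq_smult:
  assumes \<phi>: "J_holomorphic_curve A \<phi>" and s: "local_section A \<phi> U c W s" and z: "z \<in> W"
  shows "dphi s z \<xi> = \<xi> *s dphi s z 1"
proof -
  have l: "linear (mc s z)" by (rule linear_mc [OF local_section_differentiable [OF s z]])
  have J: "dphi s z (\<i> * \<xi>) = \<i> *s dphi s z \<xi>" for \<xi>
    using \<phi> s z unfolding J_holomorphic_curve_def by blast
  have "dphi s z \<xi> = dphi s z (Re \<xi> *\<^sub>R 1 + Im \<xi> *\<^sub>R (\<i> * 1))"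
    by (simp add: scaleR_conv_of_real mult.commute flip: complex_eq)
  also have "\<dots> = of_real (Re \<xi>) *s dphi s z 1 + of_real (Im \<xi>) *s dphi s z (\<i> * 1)"
    unfolding dphi_def \<omega>1_def \<omega>2_def \<omega>3_def linear_add [OF l] linear_scale [OF l]
    by (simp add: vec_eq_iff forall_3 scaleR_conv_of_real algebra_simps)
  also have "\<dots> = (of_real (Re \<xi>) + \<i> * of_real (Im \<xi>)) *s dphi s z 1"
    unfolding J by (simp add: vec_eq_iff algebra_simps)
  finally show ?thesis by (simp flip: complex_eq)
qed

lemma transverse_dphi_nonzero:
  assumes \<phi>: "transverse_curve A \<phi>" and s: "local_section A \<phi> U c W s" and z: "z \<in> W" and \<xi>: "\<xi> \<noteq> 0"
  shows "norm_V (dphi s z \<xi>) > 0" "norm_H (dphi s z \<xi>) > 0"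
proof -
  have "dphi s z \<xi> \<notin> horizontal" "dphi s z \<xi> \<notin> vertical"
    using \<phi> s z \<xi> unfolding transverse_curve_def by blast+
  then show "norm_V (dphi s z \<xi>) > 0" "norm_H (dphi s z \<xi>) > 0"
    by (auto simp: norm_V_def norm_H_def horizontal_def vertical_def add_pos_nonneg add_nonneg_pos)
qed

text \<open>A holomorphic change of coordinates acts on tangent vectors as multiplication by its
  derivative \<open>k\<close>. Transporting \<open>s'\<close> to the first coordinate reduces the
  claim to two lifts over a common domain.\<close>

lemma norms_independent_of_chart:
  assumes A: "riemann_surface A"
    and s: "local_section A \<phi> U c W s" "x \<in> U" "c x \<in> W"
    and s': "local_section A \<phi> V d W' s'" "x \<in> V" "d x \<in> W'"
  obtains k where "\<And>\<xi>. norm_V (dphi s' (d x) (k * \<xi>)) = norm_V (dphi s (c x) \<xi>)"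
    "\<And>\<xi>. norm_H (dphi s' (d x) (k * \<xi>)) = norm_H (dphi s (c x) \<xi>)"
proof -
  have UA: "(U, c) \<in> A" and VA: "(V, d) \<in> A" using s s' by (auto simp: local_section_def)
  note U = riemann_surface_chart [OF A UA] and V = riemann_surface_chart [OF A VA]
  define \<psi> where "\<psi> = d \<circ> inv_into U c"
  have hol: "\<psi> holomorphic_on c ` (U \<inter> V)"
    using A UA VA unfolding riemann_surface_def \<psi>_def by fast
  have inv: "inv_into U c (c y) = y" if "y \<in> U" for y
    using U(4) that by simp
  have open1: "open (c ` (U \<inter> V))"
  proof -
    have "openin (top_of_set (c ` U)) (c ` (U \<inter> V))"
      by (rule homeomorphism_imp_open_map [OF U(3)]) (use V(1) in \<open>auto simp: openin_open\<close>)
    then show ?thesis using U(2) openin_open_eq by blast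
  qed
  \<comment> \<open>The part of \<open>W\<close> on which \<open>s' \<circ> \<psi>\<close> is a lift
    too.\<close>
  define S where "S = W \<inter> (c ` (U \<inter> V) \<inter> \<psi> -` W')"
  have W: "open W" "open W'" using s s' by (auto simp: local_section_def)
  have "open S"
    unfolding S_def using continuous_open_preimage [OF holomorphic_on_imp_continuous_on [OF hol] open1 W(2)] W(1)
    by (rule_tac open_Int)
  have \<psi>x: "\<psi> (c x) = d x" using inv [OF s(2)] by (simp add: \<psi>_def)
  have "c x \<in> S" using s s' \<psi>x by (auto simp: S_def)
  have "\<psi> field_differentiable (at (c x))"
    using hol open1 s(2) s'(2) by (auto simp: holomorphic_on_open field_differentiable_def)
  then obtain k where "(\<psi> has_field_derivative k) (at (c x))"
    unfolding field_differentiable_def by blast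
  then have D\<psi>: "(\<psi> has_derivative (*) k) (at (c x))"
    by (simp add: has_field_derivative_def)
  define t where "t = s' \<circ> \<psi>"
  have "(s' has_derivative frechet_derivative s' (at (d x))) (at (\<psi> (c x)))"
    unfolding \<psi>x using local_section_differentiable [OF s'(1,3)] by (simp add: frechet_derivative_works)
  from has_derivative_compose [OF D\<psi> this]
  have Dt: "(t has_derivative (\<lambda>\<xi>. frechet_derivative s' (at (d x)) (k * \<xi>))) (at (c x))"
    by (simp add: t_def comp_def)
  have mct: "mc t (c x) \<xi> = mc s' (d x) (k * \<xi>)" for \<xi>
    unfolding mc_def frechet_derivative_eqI [OF Dt] by (simp add: t_def \<psi>x)
  have Sp: "s y \<in> Sp2 \<and> t y \<in> Sp2" if "y \<in> S" for y
    using s(1) s'(1) that by (auto simp: local_section_def S_def t_def)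
  have proj: "Sp2_proj (t y) = Sp2_proj (s y)" if y: "y \<in> S" for y
  proof -
    obtain p where p: "y = c p" "p \<in> U" "p \<in> V" using y by (auto simp: S_def)
    have "Sp2_proj (t y) = \<phi> (inv_into V d (\<psi> y))"
      using s'(1) y by (simp add: local_section_def S_def t_def)
    moreover have "\<psi> y = d p" using inv p by (simp add: \<psi>_def)
    moreover have "Sp2_proj (s y) = \<phi> (inv_into U c y)"
      using s(1) y by (simp add: local_section_def S_def)
    ultimately show ?thesis using p inv V(4) by simp
  qed
  have "t differentiable (at (c x))" using Dt differentiable_def by blast
  note * = norms_independent_of_lift [OF \<open>open S\<close> \<open>c x \<in> S\<close> Sp proj local_section_differentiable [OF s(1,3)] this]
  show ?thesis
    by (rule that [of k]) (use * in \<open>simp_all add: norm_H_dphi norm_V_dphi mct\<close>)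
qed

lemma norm_smult: "norm_V (k *s w) = cmod k * norm_V w" "norm_H (k *s w) = cmod k * norm_H w"
proof -
  show "norm_V (k *s w) = cmod k * norm_V w" by (simp add: norm_V_def norm_mult)
  have "norm_H (k *s w) = sqrt ((cmod k)\<^sup>2 * ((cmod (w $ 1))\<^sup>2 + (cmod (w $ 2))\<^sup>2))"
    by (simp add: norm_H_def norm_mult power_mult_distrib distrib_left)
  then show "norm_H (k *s w) = cmod k * norm_H w"
    by (simp add: real_sqrt_mult norm_H_def)
qed

text \<open>Both norms scale by the modulus of the tangent vector, so their quotient does not depend
  on it; \<open>norms_independent_of_chart\<close> removes the dependence on chart and lift. The
  description defining \<open>angle_function\<close> therefore singles out one value.\<close>

lemma angle_function_eq:
  assumes A: "riemann_surface A" and \<phi>: "transverse_curve A \<phi>"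
    and s: "local_section A \<phi> U c W s" "x \<in> U" "c x \<in> W" and \<xi>: "\<xi> \<noteq> 0"
  shows "angle_function A \<phi> x = norm_V (dphi s (c x) \<xi>) / norm_H (dphi s (c x) \<xi>)"
proof -
  have J: "J_holomorphic_curve A \<phi>" using \<phi> by (simp add: transverse_curve_def)
  let ?r = "norm_V (dphi s (c x) \<xi>) / norm_H (dphi s (c x) \<xi>)"
  show ?thesis
    unfolding angle_function_def
  proof (rule the_equality)
    show "\<forall>U c W s. local_section A \<phi> U c W s \<and> x \<in> U \<and> c x \<in> W \<longrightarrow>
        (\<forall>\<eta>. \<eta> \<noteq> 0 \<longrightarrow> ?r = norm_V (dphi s (c x) \<eta>) / norm_H (dphi s (c x) \<eta>))"
    proof (intro allI impI, elim conjE)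
      fix V d W' s' and \<eta> :: complex
      assume s': "local_section A \<phi> V d W' s'" "x \<in> V" "d x \<in> W'" and \<eta>: "\<eta> \<noteq> 0"
      obtain k where k: "\<And>\<xi>. norm_V (dphi s' (d x) (k * \<xi>)) = norm_V (dphi s (c x) \<xi>)"
        "\<And>\<xi>. norm_H (dphi s' (d x) (k * \<xi>)) = norm_H (dphi s (c x) \<xi>)"
        using norms_independent_of_chart [OF A s s'] by blast
      have sm: "dphi s' (d x) \<zeta> = \<zeta> *s dphi s' (d x) 1" for \<zeta>
        by (rule dphi_eq_smult [OF J s'(1,3)])
      \<comment> \<open>Transversality shows that \<open>k * \<xi>\<close> is not zero, as the zero
        vector would have vertical norm 0.\<close>
      have "norm_V (dphi s' (d x) (k * \<xi>)) \<noteq> 0"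
        unfolding k using transverse_dphi_nonzero(1) [OF \<phi> s(1,3) \<xi>] by simp
      then have "k * \<xi> \<noteq> 0" by (subst (asm) sm) (auto simp: norm_smult)
      have "norm_V (dphi s' (d x) \<zeta>) / norm_H (dphi s' (d x) \<zeta>) =
        norm_V (dphi s' (d x) 1) / norm_H (dphi s' (d x) 1)" if "\<zeta> \<noteq> 0" for \<zeta>
        using that by (subst (1 2) sm) (simp add: norm_smult)
      then show "?r = norm_V (dphi s' (d x) \<eta>) / norm_H (dphi s' (d x) \<eta>)"
        using \<eta> \<open>k * \<xi> \<noteq> 0\<close> unfolding k [symmetric] by metis
    qed
    show "r = ?r" if "\<forall>U c W s. local_section A \<phi> U c W s \<and> x \<in> U \<and> c x \<in> W \<longrightarrow>
        (\<forall>\<eta>. \<eta> \<noteq> 0 \<longrightarrow> r = norm_V (dphi s (c x) \<eta>) / norm_H (dphi s (c x) \<eta>))" for r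
      using that s \<xi> by blast
  qed
qed

section \<open>Existence of sections of \<open>Q\<close>\<close>

lemma ex_Q_section:
  assumes A: "riemann_surface A" and \<phi>: "transverse_curve A \<phi>"
  obtains U c W s where "Q_section A \<phi> U c W s" "x \<in> U" "c x \<in> W"
proof -
  have J: "J_holomorphic_curve A \<phi>" and "smooth_into_CP3 A \<phi>"
    using \<phi> by (auto simp: transverse_curve_def J_holomorphic_curve_def)
  then obtain U c W s where s: "local_section A \<phi> U c W s" and x: "x \<in> U" "c x \<in> W"
    using ex_local_section [OF A] by metis
  have W: "open W" and ss: "smooth_on W s" using s by (auto simp: local_section_def)
  define m where "m z = mc s z 1 $ 2 $ 1" for z
  define n where "n z = snd (mc s z 1 $ 1 $ 1)" for z
  have mn: "m z \<noteq> 0" "n z \<noteq> 0" if "z \<in> W" for z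
    using transverse_dphi_nonzero [OF \<phi> s that, of 1] by (auto simp: norm_H_dphi norm_V_dphi m_def n_def zero_less_mult_iff)
  \<comment> \<open>The first factor turns \<open>m = (\<omega>1 + j \<omega>2) / sqrt 2\<close>
    into its norm, the second gives \<open>\<omega>1\<close> the phase of
    \<open>\<omega>3 = cnj n\<close>.\<close>
  define q where "q z = qmul (sgn (m z)) (sgn (n z), 0)" for z
  have q: "smooth_on W q" "\<forall>z\<in>W. norm (q z) = 1"
  proof -
    have "smooth_on W m" "smooth_on W n"
      unfolding m_def [abs_def] n_def [abs_def] by (intro smooth_on_snd smooth_on_nth smooth_on_mc W ss)+
    then show "smooth_on W q"
      unfolding q_def [abs_def]
      by (intro smooth_on_bilinear [OF bounded_bilinear_qmul] smooth_on_Pair smooth_on_sgn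
          smooth_on_const W mn)
  qed (use mn in \<open>simp add: q_def norm_qmul norm_Pair norm_sgn\<close>)
  define s' where "s' = (\<lambda>z. qmat (s z $ 1 $ 1) (qmul (s z $ 1 $ 2) (q z)) (s z $ 2 $ 1) (qmul (s z $ 2 $ 2) (q z)))"
  note s' = gauge_section [OF s q, folded s'_def]
  have "\<omega>2 s' z \<xi> = 0 \<and> \<omega>3 s' z \<xi> = of_real (angle_function A \<phi> (inv_into U c z)) * \<omega>1 s' z \<xi>"
    if z: "z \<in> W" for z \<xi>
  proof -
    have "qmul (qcnj (q z)) (m z) = qmul (qcnj (sgn (n z), 0)) (qmul (qcnj (sgn (m z))) (m z))"
      by (simp add: q_def qcnj_qmul qmul_assoc)
    also have "qmul (qcnj (sgn (m z))) (m z) = (of_real (norm (m z)), 0)"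
      using mn [OF z] by (simp add: sgn_div_norm qmul_linear qmul_qcnj power2_eq_square scaleR_conv_of_real)
    finally have m': "mc s' z 1 $ 2 $ 1 = (cnj (sgn (n z)) * of_real (norm (m z)), 0)"
      using s'(3) [OF z, of 1] by (simp add: m_def [symmetric] qmul_def qcnj_def)
    have "angle_function A \<phi> (inv_into U c z) = norm_V (dphi s z 1) / norm_H (dphi s z 1)"
      using angle_function_eq [OF A \<phi> s, of "inv_into U c z" 1] local_section_chart [OF A s z] z by simp
    then have a: "angle_function A \<phi> (inv_into U c z) = cmod (n z) / (sqrt 2 * norm (m z))"
      by (simp add: norm_H_dphi norm_V_dphi m_def n_def)
    have n': "cnj (n z) = of_real (cmod (n z)) * cnj (sgn (n z))"
      using mn(2) [OF z] by (simp add: sgn_div_norm scaleR_conv_of_real)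
    have "\<omega>2 s' z 1 = 0" by (simp add: \<omega>2_def m')
    moreover have "\<omega>3 s' z 1 = of_real (angle_function A \<phi> (inv_into U c z)) * \<omega>1 s' z 1"
    proof -
      have "\<omega>3 s' z 1 = cnj (n z)" by (simp add: \<omega>3_def s'(2) [OF z] n_def)
      then show ?thesis
        using mn(1) [OF z] unfolding a n' by (simp add: \<omega>1_def m')
    qed
    moreover have "dphi s' z \<xi> = \<xi> *s dphi s' z 1" by (rule dphi_eq_smult [OF J s'(1) z])
    then have "\<omega>1 s' z \<xi> = \<xi> * \<omega>1 s' z 1" "\<omega>2 s' z \<xi> = \<xi> * \<omega>2 s' z 1" "\<omega>3 s' z \<xi> = \<xi> * \<omega>3 s' z 1"
      by (simp_all add: dphi_def vec_eq_iff forall_3)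
    ultimately show ?thesis by simp
  qed
  then have "Q_section A \<phi> U c W s'" using s'(1) by (simp add: Q_section_def)
  then show ?thesis using that x by blast
qed

lemma Q_section_Q_lift:
  assumes \<phi>: "transverse_curve A \<phi>" and s: "Q_section A \<phi> U c W s"
  shows "Q_lift W s (\<lambda>z. angle_function A \<phi> (inv_into U c z))"
proof
  have l: "local_section A \<phi> U c W s" using s by (simp add: Q_section_def)
  then show "open W" "smooth_on W s" "\<And>y. y \<in> W \<Longrightarrow> s y \<in> Sp2"
    by (auto simp: local_section_def)
  show \<omega>2: "\<omega>2 s y v = 0" and "\<omega>3 s y v = of_real (angle_function A \<phi> (inv_into U c y)) * \<omega>1 s y v"
    if "y \<in> W" for y v
    using s that by (auto simp: Q_section_def)
  have J: "J_holomorphic_curve A \<phi>" using \<phi> by (simp add: transverse_curve_def)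
  show "\<omega>1 s y (\<i> * v) = \<i> * \<omega>1 s y v" if "y \<in> W" for y v
  proof -
    have "dphi s y (\<i> * v) = \<i> *s dphi s y v"
      using J l that unfolding J_holomorphic_curve_def by blast
    then show ?thesis by (simp add: dphi_def vec_eq_iff forall_3)
  qed
  \<comment> \<open>With \<open>\<omega>2 = 0\<close> the horizontal norm is
    \<open>|\<omega>1|\<close>, which is positive as the curve is nowhere vertical.\<close>
  show "\<omega>1 s y 1 \<noteq> 0" if "y \<in> W" for y
    using transverse_dphi_nonzero(2) [OF \<phi> l that, of 1] \<omega>2 [OF that] by (auto simp: norm_H_def dphi_def)
qed

section \<open>The formula and the nonexistence statement\<close>

theorem theorem4p10:
  fixes A :: "'x::t2_space atlas" and \<phi> :: "'x \<Rightarrow> (complex^4) set"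
  assumes "riemann_surface A" and "transverse_curve A \<phi>"
  shows "(\<forall>x. \<exists>U c W s. Q_section A \<phi> U c W s \<and> x \<in> U \<and> c x \<in> W) \<and>
    (\<forall>U c W s z v w \<xi>. Q_section A \<phi> U c W s \<and> z \<in> W \<longrightarrow>
       (let \<alpha> = angle_function A \<phi> (inv_into U c z) in
        d_nabla s (II s) z v w \<xi> =
          (2 * \<i> * of_real \<alpha> / of_real (\<alpha>\<^sup>2 + 1) * of_real (- 2 + 3 * \<alpha>\<^sup>2) *
             vol_H s z v w * u_coframe \<alpha> 1 (dphi s z \<xi>)) *s f_frame \<alpha> 2)) \<and>
    \<not> holomorphic_II A \<phi>"
proof (intro conjI allI impI)
  show "\<exists>U c W s. Q_section A \<phi> U c W s \<and> x \<in> U \<and> c x \<in> W" for x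
    using ex_Q_section [OF assms] by metis
next
  fix U c W s z v w \<xi>
  assume "Q_section A \<phi> U c W s \<and> z \<in> W"
  then interpret Q_lift W s "\<lambda>z. angle_function A \<phi> (inv_into U c z)"
    using Q_section_Q_lift [OF assms(2)] by blast
  show "let \<alpha> = angle_function A \<phi> (inv_into U c z) in
        d_nabla s (II s) z v w \<xi> =
          (2 * \<i> * of_real \<alpha> / of_real (\<alpha>\<^sup>2 + 1) * of_real (- 2 + 3 * \<alpha>\<^sup>2) *
             vol_H s z v w * u_coframe \<alpha> 1 (dphi s z \<xi>)) *s f_frame \<alpha> 2"
    unfolding Let_def by (rule d_nabla_II) (use \<open>_ \<and> z \<in> W\<close> in blast)
next
  show "\<not> holomorphic_II A \<phi>"
  proof
    assume hol: "holomorphic_II A \<phi>"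
    \<comment> \<open>Types are inhabited, so the surface has a point \<open>x\<close>.\<close>
    obtain U c W s and x :: 'x where Q: "Q_section A \<phi> U c W s" and x: "x \<in> U" "c x \<in> W"
      using ex_Q_section [OF assms] by metis
    have l: "local_section A \<phi> U c W s" using Q by (simp add: Q_section_def)
    interpret Q_lift W s "\<lambda>z. angle_function A \<phi> (inv_into U c z)"
      by (rule Q_section_Q_lift [OF assms(2) Q])
    have "(angle_function A \<phi> (inv_into U c z))\<^sup>2 = 2 / 3" if z: "z \<in> W" for z
    proof -
      define a where "a = angle_function A \<phi> (inv_into U c z)"
      have a: "a = norm_V (dphi s z 1) / norm_H (dphi s z 1)"
        using angle_function_eq [OF assms l, of "inv_into U c z" 1] local_section_chart [OF assms(1) l z] z
        by (simp add: a_def)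
      then have "a > 0" using transverse_dphi_nonzero [OF assms(2) l z, of 1] by simp
      then have a0: "complex_of_real a \<noteq> 0" "(complex_of_real a)\<^sup>2 + 1 \<noteq> 0" "sqrt (a\<^sup>2 + 1) \<noteq> 0"
        using R_nz [of z] by (auto simp: a_def add_nonneg_eq_0_iff)
      have o: "\<omega>1 s z 1 \<noteq> 0" by (rule nz [OF z])
      have "\<omega>1 s z \<i> = \<i> * \<omega>1 s z 1" using J [OF z, of 1] by simp
      then have v: "vol_H s z 1 \<i> = \<omega>1 s z 1 * cnj (\<omega>1 s z 1)" by (simp add: vol_H_def)
      have u: "u_coframe a 1 (dphi s z 1) = \<omega>1 s z 1 * ((complex_of_real a)\<^sup>2 + 1) / of_real (sqrt (a\<^sup>2 + 1))"
        using \<omega>3 [OF z, of 1] by (simp add: u_coframe_def dphi_def a_def algebra_simps power2_eq_square)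
      have f: "f_frame a 2 $ 3 \<noteq> 0" using a0 by (simp add: f_frame_def)
      \<comment> \<open>For the vectors \<open>1\<close>, \<open>\<i>\<close> and
        \<open>\<xi> = 1\<close> the value of \<open>vol_H\<close> is
        \<open>|\<omega>1(1)|\<^sup>2\<close> and \<open>u\<^sub>1\<close> is nonzero; as the third
        component of \<open>f\<^sub>2\<close> is nonzero too, only the factor
        \<open>- 2 + 3 a\<^sup>2\<close> can vanish.\<close>
      have "(2 * \<i> * of_real a / of_real (a\<^sup>2 + 1) * of_real (- 2 + 3 * a\<^sup>2) *
             vol_H s z 1 \<i> * u_coframe a 1 (dphi s z 1)) *s f_frame a 2 = 0"
        using d_nabla_II [OF z, of 1 \<i> 1, folded a_def] hol l z unfolding holomorphic_II_def by metis
      then have "2 * \<i> * of_real a / of_real (a\<^sup>2 + 1) * of_real (- 2 + 3 * a\<^sup>2) *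
             vol_H s z 1 \<i> * u_coframe a 1 (dphi s z 1) = 0"
        using f by (metis mult_eq_0_iff vector_smult_component zero_index)
      then have "complex_of_real (- 2 + 3 * a\<^sup>2) = 0"
        unfolding u v using a0 o by simp
      then have "- 2 + 3 * a\<^sup>2 = 0" by (simp only: of_real_eq_0_iff)
      then show ?thesis by (simp add: a_def)
    qed
    from \<tau>_eq_0_if_angle_constant [OF this x(2)] have "\<tau> s (c x) v = 0" for v .
    moreover have "\<exists>\<xi>. \<tau> s (c x) \<xi> \<noteq> 0"
    proof -
      have "\<forall>U c W s. local_section A \<phi> U c W s \<and> (\<forall>z\<in>W. \<forall>\<xi>. \<omega>2 s z \<xi> = 0) \<longrightarrow>
          (\<forall>z\<in>W. \<exists>\<xi>. \<tau> s z \<xi> \<noteq> 0)"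
        using assms(2) by (simp add: transverse_curve_def)
      then show ?thesis using l \<omega>2 x(2) by blast
    qed
    ultimately show False by blast
  qed
qed

end
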